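(* Let $X_1,X_2,\ldots$ be i.i.d. symmetric random vectors with values in a real separable Banach space $E$. Assume that for some $C\geq 1$, $0<\theta<1$ and $\delta>1$ each $X_i$ satisfies $\mathrm{WB}(C,\delta,\theta)$. Let $a=(a_1,\ldots,a_n)$ and $b=(b_1,\ldots,b_n)$ be sequences of real numbers such that $a$ is majorised by $b$. Then $\sum_{i=1}^n a_iX_i$ is $(\kappa,\lambda)$-dominated by $\sum_{i=1}^n b_iX_i$ with $$\kappa=\max\{2\theta^{-1},\;96C\cdot 9^{\delta},\;12C\cdot 9^{\delta}(\delta-1)^{-1}\}\quad\text{and}\quad\lambda=2.$$
   Context: A random vector $X$ is symmetric if $X$ and $-X$ have the same distribution. A symmetric random vector $X$ with values in a real separable Banach space $E$ satisfies $\mathrm{WB}(C,\delta,\theta)$ (the weak Borell inequality with constants $C\geq 1$, $\delta>0$, $0<\theta<1$) if for every continuous norm $\|\cdot\|$ on $E$ such that $\mathbb{P}(\|X\|>1)<\theta$, we have $\mathbb{P}(\|X\|>\lambda)\leq C\lambda^{-\delta}\,\mathbb{P}(\|X\|>1)$ for all $\lambda\geq 1$. For symmetric random vectors $X,Y$ with values in $E$ and constants $\kappa,\lambda\geq 1$, $X$ is $(\kappa,\lambda)$-dominated by $Y$ if for every closed, convex and symmetric ($K=-K$) set $K\subset E$ we have $\mathbb{P}(X\notin K)\leq\kappa\,\mathbb{P}(\lambda Y\notin K)$. Equivalently: for every continuous norm $\|\cdot\|$ on $E$, $\mathbb{P}(\|X\|>1)\leq\kappa\,\mathbb{P}(\lambda\|Y\|>1)$.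 The sequence $a=(a_1,\ldots,a_n)$ is majorised by $b=(b_1,\ldots,b_n)$ if their nonincreasing rearrangements $a_1^*\geq\ldots\geq a_n^*$ and $b_1^*\geq\ldots\geq b_n^*$ satisfy $\sum_{j=1}^k a_j^*\leq\sum_{j=1}^k b_j^*$ for each $1\leq k\leq n-1$, and $\sum_{j=1}^n a_j=\sum_{j=1}^n b_j$. *)

theory Defs
  imports "HOL-Probability.Probability"
begin

text \<open>A random vector on \<open>M\<close> is a Borel measurable map \<open>X \<in> borel_measurable M\<close>. Separability of
  the Banach space is expressed by the class \<^class>\<open>second_countable_topology\<close>.\<close>

definition symmetric_rv :: "'a measure \<Rightarrow> ('a \<Rightarrow> 'b::real_normed_vector) \<Rightarrow> bool" where
  "symmetric_rv M X \<longleftrightarrow>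
     X \<in> borel_measurable M \<and> distr M borel X = distr M borel (\<lambda>\<omega>. - X \<omega>)"

text \<open>A norm on the underlying vector space that is continuous with respect to the given
  topology. It need not be equivalent to the given norm.\<close>

definition continuous_norm :: "('b::real_normed_vector \<Rightarrow> real) \<Rightarrow> bool" where
  "continuous_norm N \<longleftrightarrow>
     (\<forall>x. 0 \<le> N x) \<and>
     (\<forall>x. N x = 0 \<longleftrightarrow> x = 0) \<and>
     (\<forall>c x. N (c *\<^sub>R x) = \<bar>c\<bar> * N x) \<and>
     (\<forall>x y. N (x + y) \<le> N x + N y) \<and>
     continuous_on UNIV N"

text \<open>The weak Borell inequality \<open>WB(C, \<delta>, \<theta>)\<close>, meant for symmetric \<open>X\<close>, \<open>C \<ge> 1\<close>, \<open>\<delta> > 0\<close> and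
  \<open>0 < \<theta> < 1\<close>.\<close>

definition weak_borell ::
    "'a measure \<Rightarrow> ('a \<Rightarrow> 'b::real_normed_vector) \<Rightarrow> real \<Rightarrow> real \<Rightarrow> real \<Rightarrow> bool" where
  "weak_borell M X C \<delta> \<theta> \<longleftrightarrow>
     (\<forall>N. continuous_norm N \<longrightarrow> \<P>(\<omega> in M. N (X \<omega>) > 1) < \<theta> \<longrightarrow>
        (\<forall>l\<ge>1. \<P>(\<omega> in M. N (X \<omega>) > l) \<le> C * l powr (-\<delta>) * \<P>(\<omega> in M. N (X \<omega>) > 1)))"

text \<open>\<open>X\<close> is \<open>(\<kappa>, l)\<close>-dominated by \<open>Y\<close>, meant for symmetric random vectors and \<open>\<kappa>, l \<ge> 1\<close>.\<close>

definition dominated ::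
    "'a measure \<Rightarrow> real \<Rightarrow> real \<Rightarrow> ('a \<Rightarrow> 'b::real_normed_vector) \<Rightarrow> ('a \<Rightarrow> 'b) \<Rightarrow> bool" where
  "dominated M \<kappa> l X Y \<longleftrightarrow>
     (\<forall>K. closed K \<longrightarrow> convex K \<longrightarrow> uminus ` K = K \<longrightarrow>
        \<P>(\<omega> in M. X \<omega> \<notin> K) \<le> \<kappa> * \<P>(\<omega> in M. l *\<^sub>R Y \<omega> \<notin> K))"

definition nonincreasing_rearrangement :: "real list \<Rightarrow> real list" where
  "nonincreasing_rearrangement a = rev (sort a)"

definition majorised :: "real list \<Rightarrow> real list \<Rightarrow> bool" where
  "majorised a b \<longleftrightarrow>
     length a = length b \<and>
     (\<forall>k. 1 \<le> k \<and> k < length a \<longrightarrow>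
        sum_list (take k (nonincreasing_rearrangement a))
          \<le> sum_list (take k (nonincreasing_rearrangement b))) \<and>
     sum_list a = sum_list b"

end

theory Submission
  imports Defs
begin

text \<open>
  Write \<open>S c = (\<Sum>i<n. c i *\<^sub>R X i)\<close>. Since \<open>a\<close> arises from \<open>b\<close> by successively averaging a
  vector with its image under a transposition of two coordinates, and since \<open>S c\<close> has the same law
  for all rearrangements of \<open>c\<close>, every convex functional of the sum can only decrease in the
  passage from \<open>b\<close> to \<open>a\<close> (\<open>majorised_imp_le\<close>). For a continuous norm \<open>N\<close> this
  gives \<open>E (N (S a) - 1)\<^sub>+ \<le> E (N (S b) - 1)\<^sub>+\<close>, and the left side is at least \<open>P (N (S a) > 2)\<close>. The
  factor \<open>2\<close> in the theorem is the room between the levels \<open>1\<close> and \<open>2\<close>.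

  It remains to bound \<open>E (N (S b) - 1)\<^sub>+\<close> by a multiple of \<open>p = P (N (S b) > 1)\<close>, that is, to show
  that the tail of \<open>N (S b)\<close> beyond \<open>1\<close> is integrable with total mass comparable to \<open>p\<close>. The weak
  Borell inequality is assumed for a single summand only; it passes to sums as follows. By Levy's
  inequality \<open>P (max\<^sub>i N (b i *\<^sub>R X i) > 1) \<le> 2 * p\<close>, so that every summand is in the
  range where the weak Borell inequality applies, and by independence the sum of the individual
  probabilities is at most about \<open>2 * p\<close>. Hence \<open>P (max\<^sub>i N (b i *\<^sub>R X i) > t)\<close> decays like
  \<open>C * t powr (-\<delta>) * p\<close>. The Hoffmann-Jorgensen inequality
  \<open>P (N S > 3 * t) \<le> P (max\<^sub>i N (Y i) > t) + 4 * (P (N S > t))\<^sup>2\<close> then propagates this decay along the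
  levels \<open>3 ^ k\<close>: the quadratic term is negligible because \<open>p\<close> is small
  (\<open>sum_tail_decay\<close>). As \<open>\<delta> > 1\<close>, summing \<open>3 ^ k * P (N (S b) > 3 ^ k)\<close> gives
  a convergent geometric series. The argument needs \<open>2 * p < \<theta>\<close> and
  \<open>96 * C * 9 powr \<delta> * p \<le> 1\<close>; otherwise \<open>\<kappa> * p \<ge> 1\<close> and there is nothing to prove.

  Domination quantifies over closed convex symmetric sets, which need not be unit balls of
  continuous norms. They are pointwise limits of such balls, which suffices
  (\<open>dominated_if_dominated_for_norms\<close>).
\<close>

section \<open>Continuous norms and closed convex symmetric sets\<close>

lemma continuous_normD:
  assumes "continuous_norm N"
  shows "0 \<le> N x" "N 0 = 0" "N (c *\<^sub>R x) = \<bar>c\<bar> * N x" "N (x + y) \<le> N x + N y" "N (- x) = N x"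
proof -
  show "N (- x) = N x"
    using assms unfolding continuous_norm_def by (metis abs_minus_cancel abs_one mult_1 scaleR_minus1_left)
qed (use assms in \<open>auto simp: continuous_norm_def\<close>)

lemma continuous_norm_measurable:
  "continuous_norm N \<Longrightarrow> N \<in> borel_measurable borel"
  by (auto simp: continuous_norm_def intro: borel_measurable_continuous_onI)

lemma continuous_norm_pred_greater:
  fixes f :: "'a \<Rightarrow> 'b::real_normed_vector"
  assumes "continuous_norm N" and [measurable]: "f \<in> borel_measurable M"
  shows "Measurable.pred M (\<lambda>x. N (f x) > t)"
proof -
  note [measurable] = continuous_norm_measurable[OF assms(1)]
  show ?thesis by measurable
qed

lemma continuous_norm_scale:
  assumes "continuous_norm N" "0 < c"
  shows "continuous_norm (\<lambda>x. c * N x)"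
  unfolding continuous_norm_def
proof (intro conjI allI)
  show "continuous_on UNIV (\<lambda>x. c * N x)"
    using assms(1) by (auto simp: continuous_norm_def intro: continuous_on_mult_left)
next
  fix x y
  show "c * N (x + y) \<le> c * N x + c * N y"
    using continuous_normD(4)[OF assms(1), of x y] assms(2) by (simp flip: distrib_left)
qed (use assms in \<open>auto simp: continuous_norm_def\<close>)

definition minkowski_functional :: "'b::real_normed_vector set \<Rightarrow> 'b \<Rightarrow> real" where
  "minkowski_functional U x = Inf {t. 0 < t \<and> (1 / t) *\<^sub>R x \<in> U}"

text \<open>A set between two balls around the origin has a gauge that is equivalent to the given norm: the
  inner ball makes the gauge finite and continuous, the outer ball makes it vanish only at the
  origin.\<close>

context
  fixes U :: "'b::real_normed_vector set" and r R :: real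
  assumes convex: "convex U" and sym: "\<And>x. x \<in> U \<Longrightarrow> - x \<in> U"
    and r_pos: "0 < r" and inner: "cball 0 r \<subseteq> U" and outer: "U \<subseteq> cball 0 R"
begin

lemma minkowski_functional_le:
  assumes "0 < t" "(1 / t) *\<^sub>R x \<in> U"
  shows "minkowski_functional U x \<le> t"
  unfolding minkowski_functional_def
  by (rule cInf_lower) (use assms in \<open>auto intro!: bdd_belowI[of _ 0]\<close>)

lemma minkowski_functional_less_imp:
  assumes "minkowski_functional U x < s"
  obtains t where "0 < t" "t < s" "(1 / t) *\<^sub>R x \<in> U"
proof -
  let ?T = "{t. 0 < t \<and> (1 / t) *\<^sub>R x \<in> U}"
  have pos: "0 < norm x + 1" by (simp add: add_nonneg_pos)
  have "r * norm x \<le> r * (norm x + 1)"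
    using r_pos by simp
  then have "(1 / ((norm x + 1) / r)) *\<^sub>R x \<in> cball 0 r"
    using pos r_pos by (simp add: pos_divide_le_eq)
  then have "(norm x + 1) / r \<in> ?T"
    using inner divide_pos_pos[OF pos r_pos] by blast
  moreover have "bdd_below ?T"
    by (rule bdd_belowI[of _ 0]) simp
  ultimately have "\<exists>t\<in>?T. t < s"
    using assms cInf_less_iff[of ?T s] unfolding minkowski_functional_def by blast
  then show ?thesis using that by blast
qed

lemma minkowski_functional_ge:
  assumes "\<And>t. 0 < t \<Longrightarrow> (1 / t) *\<^sub>R x \<in> U \<Longrightarrow> y \<le> t"
  shows "y \<le> minkowski_functional U x"
proof (rule ccontr)
  assume "\<not> y \<le> minkowski_functional U x"
  then have "minkowski_functional U x < y" by simp
  then obtain t where "0 < t" "t < y" "(1 / t) *\<^sub>R x \<in> U"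
    by (rule minkowski_functional_less_imp)
  then show False using assms[of t] by simp
qed

lemma minkowski_functional_le_norm: "minkowski_functional U x \<le> norm x / r"
proof (rule field_le_epsilon)
  fix e :: real assume "0 < e"
  have pos: "0 < norm x / r + e"
    using r_pos \<open>0 < e\<close> by (simp add: add_nonneg_pos)
  have "norm x \<le> r * (norm x / r + e)"
    using r_pos \<open>0 < e\<close> by (simp add: distrib_left)
  then have "(1 / (norm x / r + e)) *\<^sub>R x \<in> cball 0 r"
    using pos by (simp add: pos_divide_le_eq)
  then show "minkowski_functional U x \<le> norm x / r + e"
    using inner pos by (intro minkowski_functional_le) auto
qed

lemma norm_le_minkowski_functional: "norm x \<le> R * minkowski_functional U x"
proof -
  \<comment> \<open>The two balls compare their radii only if the space contains a nonzero vector.\<close>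
  have "r \<le> R \<or> (\<forall>x::'b. x = 0)"
  proof (rule disjCI)
    assume "\<not> (\<forall>x::'b. x = 0)"
    then obtain z :: 'b where "z \<noteq> 0" by blast
    then have "(r / norm z) *\<^sub>R z \<in> cball 0 r" using r_pos by simp
    then have "(r / norm z) *\<^sub>R z \<in> cball 0 R" using inner outer by blast
    then show "r \<le> R" using \<open>z \<noteq> 0\<close> r_pos by simp
  qed
  then show ?thesis
  proof
    assume "r \<le> R"
    then have R: "0 < R" using r_pos by simp
    have "norm x / R \<le> minkowski_functional U x"
    proof (rule minkowski_functional_ge)
      fix t :: real assume "0 < t" "(1 / t) *\<^sub>R x \<in> U"
      then have "(1 / t) *\<^sub>R x \<in> cball 0 R" using outer by blast
      then show "norm x / R \<le> t" using \<open>0 < t\<close> R by (simp add: field_simps)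
    qed
    then show ?thesis using R by (simp add: field_simps)
  next
    assume "\<forall>x::'b. x = 0"
    then have x: "x = 0" by blast
    have "minkowski_functional U x = 0"
      using minkowski_functional_le_norm[of x]
      by (intro antisym minkowski_functional_ge) (auto simp: x)
    then show ?thesis by (simp add: x)
  qed
qed

lemma minkowski_functional_triangle:
  "minkowski_functional U (x + y) \<le> minkowski_functional U x + minkowski_functional U y"
proof (rule field_le_epsilon)
  fix e :: real assume "0 < e"
  obtain s where s: "0 < s" "s < minkowski_functional U x + e / 2" "(1 / s) *\<^sub>R x \<in> U"
    by (rule minkowski_functional_less_imp[of x "minkowski_functional U x + e / 2"])
      (use \<open>0 < e\<close> in simp)
  obtain t where t: "0 < t" "t < minkowski_functional U y + e / 2" "(1 / t) *\<^sub>R y \<in> U"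
    by (rule minkowski_functional_less_imp[of y "minkowski_functional U y + e / 2"])
      (use \<open>0 < e\<close> in simp)
  have st: "0 < s + t" using s t by simp
  have "(s / (s + t)) *\<^sub>R ((1 / s) *\<^sub>R x) + (t / (s + t)) *\<^sub>R ((1 / t) *\<^sub>R y) \<in> U"
  proof (rule convexD[OF convex s(3) t(3)])
    show "0 \<le> s / (s + t)" "0 \<le> t / (s + t)" using s(1) t(1) by simp_all
    show "s / (s + t) + t / (s + t) = 1"
      using st by (subst add_divide_distrib[symmetric]) simp
  qed
  also have "(s / (s + t)) *\<^sub>R ((1 / s) *\<^sub>R x) + (t / (s + t)) *\<^sub>R ((1 / t) *\<^sub>R y)
      = (1 / (s + t)) *\<^sub>R (x + y)"
    using s(1) t(1) by (simp only: scaleR_scaleR scaleR_add_right) simp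
  finally have "minkowski_functional U (x + y) \<le> s + t"
    using st by (intro minkowski_functional_le)
  then show "minkowski_functional U (x + y)
      \<le> minkowski_functional U x + minkowski_functional U y + e"
    using s(2) t(2) by linarith
qed

lemma minkowski_functional_scaleR:
  "minkowski_functional U (c *\<^sub>R x) = \<bar>c\<bar> * minkowski_functional U x"
proof -
  have le: "minkowski_functional U (c *\<^sub>R x) \<le> \<bar>c\<bar> * minkowski_functional U x"
    if "c \<noteq> 0" for c :: real and x
  proof -
    have "minkowski_functional U (c *\<^sub>R x) / \<bar>c\<bar> \<le> minkowski_functional U x"
    proof (rule minkowski_functional_ge)
      fix t :: real assume t: "0 < t" "(1 / t) *\<^sub>R x \<in> U"
      have "(1 / (\<bar>c\<bar> * t)) *\<^sub>R (c *\<^sub>R x) = sgn c *\<^sub>R ((1 / t) *\<^sub>R x)"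
        using that t by (simp add: sgn_if)
      moreover have "sgn c *\<^sub>R ((1 / t) *\<^sub>R x) \<in> U"
        using that t sym[OF t(2)] by (simp add: sgn_if)
      ultimately have "minkowski_functional U (c *\<^sub>R x) \<le> \<bar>c\<bar> * t"
        using that t by (intro minkowski_functional_le) auto
      then show "minkowski_functional U (c *\<^sub>R x) / \<bar>c\<bar> \<le> t"
        using that by (simp add: field_simps)
    qed
    then show ?thesis using that by (simp add: field_simps)
  qed
  show ?thesis
  proof (cases "c = 0")
    case True
    have "minkowski_functional U (0::'b) = 0"
      using minkowski_functional_le_norm[of 0]
      by (intro antisym minkowski_functional_ge) auto
    then show ?thesis using True by simp
  next
    case False
    have "minkowski_functional U ((1 / c) *\<^sub>R c *\<^sub>R x)
        \<le> \<bar>1 / c\<bar> * minkowski_functional U (c *\<^sub>R x)"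
      using False by (intro le) auto
    then have "\<bar>c\<bar> * minkowski_functional U x \<le> minkowski_functional U (c *\<^sub>R x)"
      using False by (simp add: field_simps)
    then show ?thesis using le[OF False, of x] by simp
  qed
qed

lemma continuous_norm_minkowski_functional: "continuous_norm (minkowski_functional U)"
  unfolding continuous_norm_def
proof (intro conjI allI)
  fix x :: 'b
  show nonneg: "0 \<le> minkowski_functional U x"
    by (rule minkowski_functional_ge) (rule less_imp_le)
  show "minkowski_functional U x = 0 \<longleftrightarrow> x = 0"
  proof
    assume zero: "minkowski_functional U x = 0"
    have "norm x \<le> 0"
      using norm_le_minkowski_functional[of x] unfolding zero by simp
    then show "x = 0" by simp
  next
    assume "x = 0"
    then show "minkowski_functional U x = 0"
      using minkowski_functional_scaleR[of 0 0] by simp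
  qed
next
  fix c and x y :: 'b
  show "minkowski_functional U (c *\<^sub>R x) = \<bar>c\<bar> * minkowski_functional U x"
    by (rule minkowski_functional_scaleR)
  show "minkowski_functional U (x + y) \<le> minkowski_functional U x + minkowski_functional U y"
    by (rule minkowski_functional_triangle)
next
  have le: "minkowski_functional U x - minkowski_functional U y \<le> (1 / r) * dist x y" for x y
  proof -
    have "minkowski_functional U x \<le> minkowski_functional U (x - y) + minkowski_functional U y"
      using minkowski_functional_triangle[of "x - y" y] by (simp only: diff_add_cancel)
    also have "minkowski_functional U (x - y) \<le> dist x y / r"
      unfolding dist_norm by (rule minkowski_functional_le_norm)
    finally show ?thesis unfolding times_divide_eq_left mult_1 by linarith
  qed
  have "(1 / r)-lipschitz_on UNIV (minkowski_functional U)"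
  proof (rule lipschitz_onI)
    fix x y :: 'b
    show "dist (minkowski_functional U x) (minkowski_functional U y) \<le> 1 / r * dist x y"
      using le[of x y] le[of y x] unfolding dist_real_def dist_commute[of y x] by linarith
  qed (use r_pos in simp)
  then show "continuous_on UNIV (minkowski_functional U)"
    by (rule lipschitz_on_continuous_on)
qed

lemma minkowski_functional_less_1_imp_mem:
  assumes "minkowski_functional U x < 1"
  shows "x \<in> U"
proof -
  obtain t where t: "0 < t" "t < 1" "(1 / t) *\<^sub>R x \<in> U"
    using minkowski_functional_less_imp[OF assms] .
  have "0 \<in> U" using inner r_pos by auto
  then have "t *\<^sub>R ((1 / t) *\<^sub>R x) + (1 - t) *\<^sub>R 0 \<in> U"
    using t by (intro convexD[OF convex]) auto
  then show ?thesis using t by simp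
qed

end

text \<open>The set itself need not be the unit ball of a continuous norm: it may be unbounded and have
  empty interior. Thickening it by a small ball and cutting it off by a large one cures both
  defects, and as the radii tend to zero and to infinity the unit balls of the resulting norms
  converge to the set pointwise because it is closed.\<close>
lemma closed_convex_symmetric_limit_of_norm_balls:
  fixes K :: "'b::real_normed_vector set"
  assumes "closed K" "convex K" "uminus ` K = K" "K \<noteq> {}"
  obtains N where "\<And>m::nat. continuous_norm (N m)"
    and "\<And>x. \<forall>\<^sub>F m in sequentially. N m x > 1 \<longleftrightarrow> x \<notin> K"
proof -
  have symK: "- x \<in> K" if "x \<in> K" for x using assms(3) that by blast
  obtain k where "k \<in> K" using assms(4) by blast
  have "(1/2) *\<^sub>R k + (1/2) *\<^sub>R (- k) \<in> K"
    using \<open>k \<in> K\<close> symK by (intro convexD[OF assms(2)]) auto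
  then have zero: "0 \<in> K" by simp
  define e :: "nat \<Rightarrow> real" where "e m = 1 / Suc m" for m
  have e: "0 < e m" "e m \<le> 1" for m by (auto simp: e_def)
  define U where
    "U m = (\<Union>x\<in>K. \<Union>y\<in>cball 0 (e m). {x + y}) \<inter> cball 0 (1 / e m)" for m
  have conv: "convex (U m)" for m
    unfolding U_def by (intro convex_Int convex_sums assms) auto
  have sym: "- x \<in> U m" if x: "x \<in> U m" for x m
  proof -
    obtain y z where "y \<in> K" "z \<in> cball 0 (e m)" "x = y + z"
      using x by (auto simp: U_def)
    then have "- y \<in> K" "- z \<in> cball 0 (e m)" "- x = - y + - z"
      using symK by auto
    then have "- x \<in> (\<Union>x\<in>K. \<Union>y\<in>cball 0 (e m). {x + y})" by blast
    then show ?thesis using x by (simp add: U_def)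
  qed
  have inner: "cball 0 (e m) \<subseteq> U m" for m
  proof
    fix x :: 'b assume x: "x \<in> cball 0 (e m)"
    have "e m \<le> 1 / e m" using e[of m] by (simp add: le_divide_eq mult_le_one)
    have "x = 0 + x" by simp
    then have "x \<in> (\<Union>x\<in>K. \<Union>y\<in>cball 0 (e m). {x + y})" using x zero by blast
    then show "x \<in> U m"
      using x \<open>e m \<le> 1 / e m\<close> by (simp add: U_def)
  qed
  have outer: "U m \<subseteq> cball 0 (1 / e m)" for m by (auto simp: U_def)
  note facts = conv sym e(1) inner outer
  have mem: "x \<in> U m" if "minkowski_functional (U m) x < 1" for x m
    by (rule minkowski_functional_less_1_imp_mem[OF conv sym e(1) inner outer that])
  have lim: "\<forall>\<^sub>F m in sequentially. minkowski_functional (U m) x > 1 \<longleftrightarrow> x \<notin> K" for x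
  proof (cases "x \<in> K")
    case True
    have "\<forall>\<^sub>F m in sequentially. norm x \<le> real (Suc m)"
      by real_asymp
    then show ?thesis
    proof eventually_elim
      case (elim m)
      have "x = x + 0" "0 \<in> cball 0 (e m)" using e(1)[of m] by simp_all
      then have "x \<in> (\<Union>x\<in>K. \<Union>y\<in>cball 0 (e m). {x + y})" using True by blast
      then have "x \<in> U m" using elim by (simp add: U_def e_def)
      then have "minkowski_functional (U m) x \<le> 1"
        by (intro minkowski_functional_le[OF facts]) auto
      then show ?case using True by simp
    qed
  next
    case False
    then have pos: "0 < infdist x K"
      using assms by (intro infdist_pos_not_in_closed)
    have "\<forall>\<^sub>F m in sequentially. 1 / real (Suc m) < infdist x K"
      using pos by real_asymp
    then show ?thesis
    proof eventually_elim
      case (elim m)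
      have "\<not> minkowski_functional (U m) x \<le> 1"
      proof
        assume le: "minkowski_functional (U m) x \<le> 1"
        \<comment> \<open>A gauge equal to one does not yet put \<open>x\<close> into \<open>U m\<close>, so shrink \<open>x\<close> slightly.\<close>
        have near: "infdist (s *\<^sub>R x) K \<le> e m" if "0 < s" "s < 1" for s
        proof -
          have "s * minkowski_functional (U m) x \<le> s * 1"
            using le that by (intro mult_left_mono) auto
          also have "s * 1 < 1" using that by simp
          finally have "minkowski_functional (U m) (s *\<^sub>R x) < 1"
            using that by (simp add: minkowski_functional_scaleR[OF facts])
          then have "s *\<^sub>R x \<in> U m"
            by (rule mem)
          then obtain y z where "y \<in> K" "z \<in> cball 0 (e m)" "s *\<^sub>R x = y + z"
            by (auto simp: U_def)
          then show ?thesis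
            by (intro infdist_le2[of y]) (auto simp: dist_norm)
        qed
        have "((\<lambda>s. infdist (s *\<^sub>R x) K) \<longlongrightarrow> infdist (1 *\<^sub>R x) K) (at_left 1)"
          by (intro tendsto_intros)
        moreover have "\<forall>\<^sub>F s in at_left (1::real). infdist (s *\<^sub>R x) K \<le> e m"
          using near by (intro eventually_at_leftI[of 0]) auto
        ultimately have "infdist (1 *\<^sub>R x) K \<le> e m"
          by (rule tendsto_upperbound) simp
        then show False using elim by (simp add: e_def)
      qed
      then show ?case using False by simp
    qed
  qed
  show ?thesis
  proof (rule that)
    show "continuous_norm (minkowski_functional (U m))" for m
      by (rule continuous_norm_minkowski_functional[OF conv sym e(1) inner outer])
  qed (rule lim)
qed

lemma (in prob_space) prob_tendsto_if_eventually_iff: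
  assumes "\<And>m::nat. Measurable.pred M (P m)" "Measurable.pred M Q"
    and "\<And>\<omega>. \<forall>\<^sub>F m in sequentially. P m \<omega> \<longleftrightarrow> Q \<omega>"
  shows "(\<lambda>m. \<P>(\<omega> in M. P m \<omega>)) \<longlonglongrightarrow> \<P>(\<omega> in M. Q \<omega>)"
proof -
  have sets: "{\<omega> \<in> space M. P m \<omega>} \<in> events" "{\<omega> \<in> space M. Q \<omega>} \<in> events" for m
    using assms by auto
  have "(\<lambda>m. expectation (indicator {\<omega> \<in> space M. P m \<omega>} :: _ \<Rightarrow> real))
      \<longlonglongrightarrow> expectation (indicator {\<omega> \<in> space M. Q \<omega>})"
  proof (rule integral_dominated_convergence[where w = "\<lambda>_. 1"])
    show "AE \<omega> in M. (\<lambda>m. indicator {\<omega> \<in> space M. P m \<omega>} \<omega> :: real)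
        \<longlonglongrightarrow> indicator {\<omega> \<in> space M. Q \<omega>} \<omega>"
    proof (rule AE_I2)
      fix \<omega> assume "\<omega> \<in> space M"
      have "\<forall>\<^sub>F m in sequentially. (indicator {\<omega> \<in> space M. P m \<omega>} \<omega> :: real)
          = indicator {\<omega> \<in> space M. Q \<omega>} \<omega>"
        using assms(3)[of \<omega>] by eventually_elim (simp add: indicator_def)
      then show "(\<lambda>m. indicator {\<omega> \<in> space M. P m \<omega>} \<omega> :: real)
          \<longlonglongrightarrow> indicator {\<omega> \<in> space M. Q \<omega>} \<omega>"
        by (rule tendsto_eventually)
    qed
  qed (use sets in \<open>auto simp: indicator_def\<close>)
  then show ?thesis using sets by simp
qed

lemma (in prob_space) dominated_if_dominated_for_norms:
  fixes X Y :: "'a \<Rightarrow> 'b::{real_normed_vector, second_countable_topology}"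
  assumes [measurable]: "X \<in> borel_measurable M" "Y \<in> borel_measurable M" and "1 \<le> \<kappa>"
    and norms: "\<And>N. continuous_norm N \<Longrightarrow>
      \<P>(\<omega> in M. N (X \<omega>) > 1) \<le> \<kappa> * \<P>(\<omega> in M. N (l *\<^sub>R Y \<omega>) > 1)"
  shows "dominated M \<kappa> l X Y"
  unfolding dominated_def
proof (intro allI impI)
  fix K :: "'b set"
  assume K: "closed K" "convex K" "uminus ` K = K"
  show "\<P>(\<omega> in M. X \<omega> \<notin> K) \<le> \<kappa> * \<P>(\<omega> in M. l *\<^sub>R Y \<omega> \<notin> K)"
  proof (cases "K = {}")
    case True
    then show ?thesis using \<open>1 \<le> \<kappa>\<close> by (simp add: prob_space)
  next
    case False
    obtain N where N: "\<And>m::nat. continuous_norm (N m)"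
      and lim: "\<And>x. \<forall>\<^sub>F m in sequentially. N m x > 1 \<longleftrightarrow> x \<notin> K"
      using closed_convex_symmetric_limit_of_norm_balls[OF K False] by blast
    have [measurable]: "N m \<in> borel_measurable borel" for m
      using N[of m] by (auto simp: continuous_norm_def intro: borel_measurable_continuous_onI)
    have [measurable]: "K \<in> sets borel" using K by auto
    have X: "(\<lambda>m. \<P>(\<omega> in M. N m (X \<omega>) > 1)) \<longlonglongrightarrow> \<P>(\<omega> in M. X \<omega> \<notin> K)"
      by (rule prob_tendsto_if_eventually_iff) (use lim in auto)
    have Y: "(\<lambda>m. \<P>(\<omega> in M. N m (l *\<^sub>R Y \<omega>) > 1)) \<longlonglongrightarrow> \<P>(\<omega> in M. l *\<^sub>R Y \<omega> \<notin> K)"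
      by (rule prob_tendsto_if_eventually_iff) (use lim in auto)
    show ?thesis
      by (rule LIMSEQ_le[OF X tendsto_mult_left[OF Y]]) (use norms[OF N] in auto)
  qed
qed

section \<open>Majorisation\<close>

text \<open>Take the first index \<open>k\<close> with \<open>b k < a k\<close> and the last index \<open>j\<close> before it with \<open>a j < b j\<close>;
  between them \<open>a\<close> and \<open>b\<close> agree. Moving mass from \<open>b j\<close> to \<open>b k\<close> until one of the two coordinates
  agrees with \<open>a\<close> keeps the partial sums above those of \<open>a\<close> and leaves fewer coordinates to correct.
  As \<open>a\<close> is nonincreasing, \<open>b k < a k \<le> a j < b j\<close>, so that this move is a convex combination of \<open>b\<close>
  and its image under the transposition of \<open>j\<close> and \<open>k\<close>. Sortedness is
  asked of \<open>a\<close> alone so that the hypotheses survive the move.\<close>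
lemma swap_convex_le_if_partial_sums_le:
  fixes a b :: "nat \<Rightarrow> real" and F :: "(nat \<Rightarrow> real) \<Rightarrow> 'c::order"
  assumes swap: "\<And>c j k s. j < n \<Longrightarrow> k < n \<Longrightarrow> 0 \<le> s \<Longrightarrow> s \<le> 1 \<Longrightarrow>
      F (\<lambda>i. (1 - s) * c i + s * c (Transposition.transpose j k i)) \<le> F c"
    and cong: "\<And>c d. (\<And>i. i < n \<Longrightarrow> c i = d i) \<Longrightarrow> F c = F d"
    and mono: "\<And>i j. i \<le> j \<Longrightarrow> j < n \<Longrightarrow> a j \<le> a i"
    and partial: "\<And>k. k < n \<Longrightarrow> (\<Sum>i<k. a i) \<le> (\<Sum>i<k. b i)"
    and total: "(\<Sum>i<n. a i) = (\<Sum>i<n. b i)"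
  shows "F a \<le> F b"
  using partial total
proof (induction "card {i. i < n \<and> a i \<noteq> b i}" arbitrary: b rule: less_induct)
  case less
  have partial: "(\<Sum>i<k. a i) \<le> (\<Sum>i<k. b i)" if "k \<le> n" for k
    using less.prems that by (cases "k = n") auto
  show ?case
  proof (cases "\<exists>k<n. b k < a k")
    case False
    then have le: "a i \<le> b i" if "i < n" for i using that by force
    then have "a i = b i" if "i < n" for i
      using sum_mono_inv[OF less.prems(2), of i] that by auto
    then show ?thesis using cong[of a b] by simp
  next
    case True
    define k where "k = (LEAST k. k < n \<and> b k < a k)"
    have k: "k < n" "b k < a k"
      using LeastI_ex[of "\<lambda>k. k < n \<and> b k < a k"] True by (auto simp: k_def)
    have before_k: "a i \<le> b i" if "i < k" for i
      using not_less_Least[of i "\<lambda>k. k < n \<and> b k < a k"] that k by (force simp: k_def)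
    have "\<exists>j<k. a j < b j"
    proof (rule ccontr)
      assume "\<not> (\<exists>j<k. a j < b j)"
      then have "(\<Sum>i<k. b i) \<le> (\<Sum>i<k. a i)" by (intro sum_mono) force
      then show False using partial[of "Suc k"] k by simp
    qed
    define j where "j = (GREATEST j. j < k \<and> a j < b j)"
    have j: "j < k" "a j < b j"
      using GreatestI_ex_nat[of "\<lambda>j. j < k \<and> a j < b j" k] \<open>\<exists>j<k. a j < b j\<close>
      by (auto simp: j_def)
    have after_j: "a i = b i" if "j < i" "i < k" for i
      using Greatest_le_nat[of "\<lambda>j. j < k \<and> a j < b j" i k] before_k[of i] that
      by (force simp: j_def)
    have mono_jk: "a k \<le> a j" using mono[of j k] j k by simp
    define d where "d = min (b j - a j) (a k - b k)"
    define s where "s = d / (b j - b k)"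
    have d: "0 < d" "d \<le> b j - a j" "d \<le> a k - b k" using j k by (auto simp: d_def)
    have gap: "0 < b j - b k" using j k mono_jk by simp
    have sd: "s * (b j - b k) = d" using gap by (simp add: s_def)
    have s: "0 \<le> s" "s \<le> 1" using d gap mono_jk by (auto simp: s_def)
    define c where "c = (\<lambda>i. (1 - s) * b i + s * b (Transposition.transpose j k i))"
    have c_j: "c j = b j - d" and c_k: "c k = b k + d"
      using sd by (auto simp: c_def algebra_simps)
    have c_other: "c i = b i" if "i \<noteq> j" "i \<noteq> k" for i
      using that by (auto simp: c_def algebra_simps)
    have sum_c: "(\<Sum>i<m. c i)
        = (\<Sum>i<m. b i) - (if j < m then d else 0) + (if k < m then d else 0)" for m
    proof -
      have "(\<Sum>i<m. c i) = (\<Sum>i<m. b i - (if i = j then d else 0) + (if i = k then d else 0))"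
        using c_j c_k c_other j by (intro sum.cong) auto
      also have "\<dots> = (\<Sum>i<m. b i) - (if j < m then d else 0) + (if k < m then d else 0)"
        by (simp add: sum.distrib sum_subtractf)
      finally show ?thesis .
    qed
    have "F a \<le> F c"
    proof (rule less.hyps)
      let ?D = "\<lambda>b. {i. i < n \<and> a i \<noteq> b i}"
      have "c j = a j \<or> c k = a k" by (auto simp: c_j c_k d_def min_def)
      then have "\<exists>i. i \<in> ?D b \<and> i \<notin> ?D c" using j k by (metis (mono_tags) less_trans less_irrefl mem_Collect_eq)
      moreover have "?D c \<subseteq> ?D b"
        using c_other j k by (auto; metis order_less_irrefl)
      ultimately show "card (?D c) < card (?D b)" by (intro psubset_card_mono) auto
    next
      show "(\<Sum>i<n. a i) = (\<Sum>i<n. c i)"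
        using less.prems(2) sum_c[of n] j k by simp
    next
      fix m assume "m < n"
      show "(\<Sum>i<m. a i) \<le> (\<Sum>i<m. c i)"
      \<comment> \<open>Only the partial sums that separate \<open>j\<close> from \<open>k\<close> drop, and there the slack is at least \<open>b j - a j\<close>.\<close>
      proof (cases "j < m \<and> m \<le> k")
        case False
        then show ?thesis using sum_c[of m] partial[of m] \<open>m < n\<close> j by auto
      next
        case True
        then have "(\<Sum>i<m. b i - a i) \<ge> (\<Sum>i\<in>{j}. b i - a i)"
          using before_k j by (intro sum_mono2) auto
        then show ?thesis
          using True sum_c[of m] d by (simp add: sum_subtractf)
      qed
    qed
    also have "F c \<le> F b"
      unfolding c_def using j k s by (intro swap) auto
    finally show ?thesis .
  qed
qed

lemma nonincreasing_rearrangement_permutes: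
  obtains p where "p permutes {..<length xs}"
    and "\<And>i. i < length xs \<Longrightarrow> nonincreasing_rearrangement xs ! i = xs ! p i"
proof -
  have "mset (nonincreasing_rearrangement xs) = mset xs"
    by (simp add: nonincreasing_rearrangement_def)
  then obtain p where p: "p permutes {..<length xs}"
      "permute_list p xs = nonincreasing_rearrangement xs"
    by (rule mset_eq_permutation)
  show ?thesis
    by (rule that[OF p(1)]) (simp add: permute_list_nth[OF p(1)] flip: p(2))
qed

lemma majorised_imp_le:
  fixes F :: "(nat \<Rightarrow> real) \<Rightarrow> 'c::order"
  assumes "majorised a b"
    and perm: "\<And>p c. p permutes {..<length a} \<Longrightarrow> F (\<lambda>i. c (p i)) = F c"
    and convex: "\<And>c j k s. j < length a \<Longrightarrow> k < length a \<Longrightarrow> 0 \<le> s \<Longrightarrow> s \<le> 1 \<Longrightarrow>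
      F (\<lambda>i. (1 - s) * c i + s * c (Transposition.transpose j k i)) \<le> F c"
    and cong: "\<And>c d. (\<And>i. i < length a \<Longrightarrow> c i = d i) \<Longrightarrow> F c = F d"
  shows "F (\<lambda>i. a ! i) \<le> F (\<lambda>i. b ! i)"
proof -
  let ?a = "nonincreasing_rearrangement a" and ?b = "nonincreasing_rearrangement b"
  define n where "n = length a"
  have len: "length b = n" "length ?a = n" "length ?b = n"
    using assms(1) by (auto simp: n_def majorised_def nonincreasing_rearrangement_def)
  have take: "(\<Sum>i<k. xs ! i) = sum_list (take k xs)" if "k \<le> length xs" for k and xs :: "real list"
    using that by (simp add: sum_list_sum_nth atLeast0LessThan)
  have rearr: "F (\<lambda>i. nonincreasing_rearrangement xs ! i) = F (\<lambda>i. xs ! i)"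
    if "length xs = n" for xs
  proof -
    obtain p where p: "p permutes {..<n}"
      "\<And>i. i < n \<Longrightarrow> nonincreasing_rearrangement xs ! i = xs ! p i"
      using nonincreasing_rearrangement_permutes[of xs] \<open>length xs = n\<close> by auto
    have "F (\<lambda>i. nonincreasing_rearrangement xs ! i) = F (\<lambda>i. xs ! p i)"
      using p(2) by (intro cong) (auto simp: n_def)
    then show ?thesis using perm[of p "\<lambda>i. xs ! i"] p(1) by (simp add: n_def)
  qed
  have "F (\<lambda>i. ?a ! i) \<le> F (\<lambda>i. ?b ! i)"
  proof (rule swap_convex_le_if_partial_sums_le[where n = n])
    fix i j assume "i \<le> j" "j < n"
    then show "?a ! j \<le> ?a ! i"
      using len unfolding nonincreasing_rearrangement_def
      by (intro sorted_rev_nth_mono) auto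
  next
    fix k assume "k < n"
    then show "(\<Sum>i<k. ?a ! i) \<le> (\<Sum>i<k. ?b ! i)"
      using assms(1) len by (cases "k = 0") (auto simp: take majorised_def n_def)
  next
    show "F (\<lambda>i. (1 - s) * c i + s * c (Transposition.transpose j k i)) \<le> F c"
      if "j < n" "k < n" "0 \<le> s" "s \<le> 1" for c j k s
      using convex that by (simp add: n_def)
    show "F c = F d" if "\<And>i. i < n \<Longrightarrow> c i = d i" for c d
      by (rule cong) (simp add: that n_def)
  next
    have "sum_list (nonincreasing_rearrangement xs) = sum_list xs" for xs :: "real list"
      unfolding nonincreasing_rearrangement_def by (metis mset_rev mset_sort sum_mset_sum_list)
    then show "(\<Sum>i<n. ?a ! i) = (\<Sum>i<n. ?b ! i)"
      using assms(1) len by (simp add: take majorised_def)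
  qed
  then show ?thesis using rearr[of a] rearr[of b] len by (simp add: n_def)
qed

section \<open>The inequalities of Levy and Hoffmann-Jorgensen\<close>

text \<open>The source of both symmetries of the problem: the joint law of independent vectors does not change
  under sign flips of symmetric ones, nor under permutations of identically distributed ones.\<close>
lemma (in prob_space) joint_law_eq:
  fixes Y Z :: "'i \<Rightarrow> 'a \<Rightarrow> 'b::topological_space"
  assumes "indep_vars (\<lambda>_. borel) Y I" "indep_vars (\<lambda>_. borel) Z I"
    and "\<And>i. i \<in> I \<Longrightarrow> distr M borel (Y i) = distr M borel (Z i)"
  shows "distr M (\<Pi>\<^sub>M i\<in>I. borel) (\<lambda>\<omega>. \<lambda>i\<in>I. Y i \<omega>) = distr M (\<Pi>\<^sub>M i\<in>I. borel) (\<lambda>\<omega>. \<lambda>i\<in>I. Z i \<omega>)"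
proof (cases "I = {}")
  case False
  have law: "distr M (\<Pi>\<^sub>M i\<in>I. borel) (\<lambda>\<omega>. \<lambda>i\<in>I. X i \<omega>) = (\<Pi>\<^sub>M i\<in>I. distr M borel (X i))"
    if "indep_vars (\<lambda>_. borel) X I" for X :: "'i \<Rightarrow> 'a \<Rightarrow> 'b"
  proof (rule indep_vars_iff_distr_eq_PiM'[OF False, THEN iffD1, OF _ that])
    show "random_variable borel (X i)" if "i \<in> I" for i
      using \<open>indep_vars (\<lambda>_. borel) X I\<close> that unfolding indep_vars_def by blast
  qed
  have "(\<Pi>\<^sub>M i\<in>I. distr M borel (Y i)) = (\<Pi>\<^sub>M i\<in>I. distr M borel (Z i))"
    by (intro PiM_cong) (use assms(3) in auto)
  then show ?thesis using law[OF assms(1)] law[OF assms(2)] by simp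
qed (simp add: restrict_def)

lemma (in prob_space) prob_joint_law_eq:
  fixes Y Z :: "'i \<Rightarrow> 'a \<Rightarrow> 'b::topological_space"
  assumes "indep_vars (\<lambda>_. borel) Y I" "indep_vars (\<lambda>_. borel) Z I"
    and "\<And>i. i \<in> I \<Longrightarrow> distr M borel (Y i) = distr M borel (Z i)"
    and P: "Measurable.pred (\<Pi>\<^sub>M i\<in>I. borel) P"
  shows "\<P>(\<omega> in M. P (\<lambda>i\<in>I. Y i \<omega>)) = \<P>(\<omega> in M. P (\<lambda>i\<in>I. Z i \<omega>))"
proof -
  have law: "\<P>(\<omega> in M. P (\<lambda>i\<in>I. X i \<omega>))
      = measure (distr M (\<Pi>\<^sub>M i\<in>I. borel) (\<lambda>\<omega>. \<lambda>i\<in>I. X i \<omega>)) {x \<in> space (\<Pi>\<^sub>M i\<in>I. borel). P x}"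
    if "indep_vars (\<lambda>_. borel) X I" for X :: "'i \<Rightarrow> 'a \<Rightarrow> 'b"
  proof -
    have [measurable]: "(\<lambda>\<omega>. \<lambda>i\<in>I. X i \<omega>) \<in> measurable M (\<Pi>\<^sub>M i\<in>I. borel)"
      using that by (intro measurable_restrict) (auto simp: indep_vars_def)
    show ?thesis
      by (subst measure_distr[OF _ predE[OF P]])
        (auto intro!: arg_cong[where f = prob] simp: space_PiM)
  qed
  show ?thesis
    using joint_law_eq[OF assms(1-3)] by (simp add: law assms(1,2))
qed

text \<open>The events on the left are disjoint, as each fixes the first index at which \<open>E\<close> occurs. Carrying
  \<open>Q\<close> along allows a bound for each first index to be added up without loss.\<close>
lemma (in prob_space) sum_prob_first_passage:
  fixes E :: "nat \<Rightarrow> 'a \<Rightarrow> bool"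
  assumes E: "\<And>k. k < m \<Longrightarrow> Measurable.pred M (E k)" and Q: "Measurable.pred M Q"
  shows "(\<Sum>k<m. \<P>(\<omega> in M. E k \<omega> \<and> (\<forall>j<k. \<not> E j \<omega>) \<and> Q \<omega>)) = \<P>(\<omega> in M. (\<exists>k<m. E k \<omega>) \<and> Q \<omega>)"
proof -
  let ?A = "\<lambda>k. {\<omega> \<in> space M. E k \<omega> \<and> (\<forall>j<k. \<not> E j \<omega>) \<and> Q \<omega>}"
  have ev: "?A k \<in> events" if "k < m" for k
  proof -
    have "{\<omega> \<in> space M. E j \<omega>} \<in> events" if "j \<le> k" for j
      by (rule predE[OF E]) (use that \<open>k < m\<close> in linarith)
    moreover have "{\<omega> \<in> space M. Q \<omega>} \<in> events" by (rule predE[OF Q])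
    moreover have "?A k = {\<omega> \<in> space M. E k \<omega>} \<inter> {\<omega> \<in> space M. Q \<omega>}
        - (\<Union>j\<in>{..<k}. {\<omega> \<in> space M. E j \<omega>})" by auto
    ultimately show ?thesis
      by (simp only:) (intro sets.Diff sets.Int sets.finite_UN, simp_all)
  qed
  have "disjoint_family_on ?A {..<m}"
    unfolding disjoint_family_on_def by (auto elim!: linorder_neqE_nat)
  then have "(\<Sum>k<m. prob (?A k)) = prob (\<Union>k\<in>{..<m}. ?A k)"
    using ev by (intro finite_measure_finite_Union[symmetric]) auto
  also have "(\<Union>k\<in>{..<m}. ?A k) = {\<omega> \<in> space M. (\<exists>k<m. E k \<omega>) \<and> Q \<omega>}"
  proof safe
    fix \<omega> k assume \<omega>: "\<omega> \<in> space M" "Q \<omega>" and k: "k < m" "E k \<omega>"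
    define l where "l = (LEAST k. E k \<omega>)"
    have "E l \<omega>" "l \<le> k" using k(2) unfolding l_def by (auto intro: LeastI Least_le)
    moreover have "\<not> E j \<omega>" if "j < l" for j using that not_less_Least unfolding l_def by blast
    ultimately show "\<omega> \<in> (\<Union>k\<in>{..<m}. ?A k)" using \<omega> k by auto
  qed auto
  finally show ?thesis .
qed

text \<open>Let \<open>k\<close> be the first index whose block sum exceeds \<open>t\<close>, and flip the signs of all terms outside
  \<open>B k\<close>. This preserves the joint law, and it preserves the norms of all block sums up to \<open>k\<close>: a
  block inside \<open>B k\<close> is untouched and a block disjoint from it only changes sign. The total sum and
  its flipped version add up to twice the sum over \<open>B k\<close>, hence one of the two has norm above \<open>t\<close>,
  and both have the same law. The blocks \<open>{..<Suc k}\<close> give the bound for the maximal partial sum, the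
  blocks \<open>{k}\<close> that for the maximal term, and a single block that for a subsum.\<close>
lemma (in prob_space) levy_inequality:
  fixes Y :: "'i \<Rightarrow> 'a \<Rightarrow> 'b::{real_normed_vector, second_countable_topology}"
    and B :: "nat \<Rightarrow> 'i set"
  assumes I: "finite I" and indep: "indep_vars (\<lambda>_. borel) Y I"
    and sym: "\<And>i. i \<in> I \<Longrightarrow> symmetric_rv M (Y i)" and N: "continuous_norm N"
    and B_I: "\<And>k. k < m \<Longrightarrow> B k \<subseteq> I"
    and B_B: "\<And>j k. j < k \<Longrightarrow> k < m \<Longrightarrow> B j \<subseteq> B k \<or> B j \<inter> B k = {}"
  shows "\<P>(\<omega> in M. \<exists>k<m. N (\<Sum>i\<in>B k. Y i \<omega>) > t) \<le> 2 * \<P>(\<omega> in M. N (\<Sum>i\<in>I. Y i \<omega>) > t)"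
proof -
  note [measurable] = continuous_norm_measurable[OF N]
  have [measurable]: "Y i \<in> borel_measurable M" if "i \<in> I" for i
    using indep that by (auto simp: indep_vars_def)
  define E where "E k x \<longleftrightarrow> t < N (\<Sum>i\<in>B k. x i)" for k and x :: "'i \<Rightarrow> 'b"
  define G where "G k x \<longleftrightarrow> E k x \<and> (\<forall>j<k. \<not> E j x)" for k and x :: "'i \<Rightarrow> 'b"
  define T where "T x \<longleftrightarrow> t < N (\<Sum>i\<in>I. x i)" for x :: "'i \<Rightarrow> 'b"
  let ?Y = "\<lambda>\<omega>. \<lambda>i\<in>I. Y i \<omega>"
  have Y[measurable]: "?Y \<in> measurable M (\<Pi>\<^sub>M i\<in>I. borel)"
    by (intro measurable_restrict) simp
  have comp: "(\<lambda>x. x i) \<in> borel_measurable (\<Pi>\<^sub>M i\<in>I. (borel :: 'b measure))" if "i \<in> I" for i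
    using that by (rule measurable_component_singleton)
  have E: "Measurable.pred (\<Pi>\<^sub>M i\<in>I. borel) (E k)" if "k < m" for k
  proof -
    have "(\<lambda>x. \<Sum>i\<in>B k. x i) \<in> borel_measurable (\<Pi>\<^sub>M i\<in>I. (borel :: 'b measure))"
      using B_I[OF that] by (intro borel_measurable_sum comp) auto
    then show ?thesis unfolding E_def by (rule continuous_norm_pred_greater[OF N])
  qed
  have G: "Measurable.pred (\<Pi>\<^sub>M i\<in>I. borel) (G k)" if "k < m" for k
  proof -
    have "Measurable.pred (\<Pi>\<^sub>M i\<in>I. borel) (\<lambda>x. \<forall>j\<in>{..<k}. \<not> E j x)"
    proof (intro pred_intros_finite pred_intros_logic)
      show "Measurable.pred (\<Pi>\<^sub>M i\<in>I. borel) (\<lambda>x. E j x)" if "j \<in> {..<k}" for j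
        by (rule E) (use that \<open>k < m\<close> in simp)
    qed simp
    with E[OF that] have "Measurable.pred (\<Pi>\<^sub>M i\<in>I. borel) (\<lambda>x. E k x \<and> (\<forall>j\<in>{..<k}. \<not> E j x))"
      by (rule pred_intros_logic)
    then show ?thesis by (simp add: G_def[abs_def] Ball_def)
  qed
  have T: "Measurable.pred (\<Pi>\<^sub>M i\<in>I. borel) T"
  proof -
    have "(\<lambda>x. \<Sum>i\<in>I. x i) \<in> borel_measurable (\<Pi>\<^sub>M i\<in>I. (borel :: 'b measure))"
      by (intro borel_measurable_sum comp)
    then show ?thesis unfolding T_def by (rule continuous_norm_pred_greater[OF N])
  qed
  have sum_Y: "(\<Sum>i\<in>B k. ?Y \<omega> i) = (\<Sum>i\<in>B k. Y i \<omega>)" if "k < m" for k \<omega>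
    using B_I[OF that] by (intro sum.cong) auto
  have E_Y: "E k (?Y \<omega>) \<longleftrightarrow> t < N (\<Sum>i\<in>B k. Y i \<omega>)" if "k < m" for k \<omega>
    by (simp only: E_def sum_Y[OF that])
  have "(\<Sum>i\<in>I. ?Y \<omega> i) = (\<Sum>i\<in>I. Y i \<omega>)" for \<omega>
    by (intro sum.cong) auto
  then have T_Y: "T (?Y \<omega>) \<longleftrightarrow> t < N (\<Sum>i\<in>I. Y i \<omega>)" for \<omega>
    by (simp only: T_def)
  have step: "\<P>(\<omega> in M. G k (?Y \<omega>)) \<le> 2 * \<P>(\<omega> in M. G k (?Y \<omega>) \<and> T (?Y \<omega>))" if k: "k < m" for k
  proof -
    note [measurable] = G[OF k] T
    define h :: "'i \<Rightarrow> 'b \<Rightarrow> 'b" where "h i = (if i \<in> B k then (\<lambda>x. x) else uminus)" for i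
    have [measurable]: "h i \<in> borel_measurable borel" for i by (simp add: h_def)
    let ?Z = "\<lambda>\<omega>. \<lambda>i\<in>I. h i (Y i \<omega>)"
    have [measurable]: "?Z \<in> measurable M (\<Pi>\<^sub>M i\<in>I. borel)"
      by (intro measurable_restrict) measurable
    have indepZ: "indep_vars (\<lambda>_. borel) (\<lambda>i \<omega>. h i (Y i \<omega>)) I"
      by (rule indep_vars_compose2[OF indep]) simp
    have law: "distr M borel (Y i) = distr M borel (\<lambda>\<omega>. h i (Y i \<omega>))" if "i \<in> I" for i
      using sym[OF that] by (simp add: h_def symmetric_rv_def)
    have flip: "(\<Sum>i\<in>A. ?Z \<omega> i) = (\<Sum>i\<in>A \<inter> B k. Y i \<omega>) - (\<Sum>i\<in>A - B k. Y i \<omega>)"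
      if "A \<subseteq> I" for A \<omega>
    proof -
      have "finite A" using that I finite_subset by blast
      have "(\<Sum>i\<in>A. ?Z \<omega> i) = (\<Sum>i\<in>A \<inter> B k. ?Z \<omega> i) + (\<Sum>i\<in>A - B k. ?Z \<omega> i)"
        using \<open>finite A\<close> by (rule sum.Int_Diff)
      moreover have "(\<Sum>i\<in>A \<inter> B k. ?Z \<omega> i) = (\<Sum>i\<in>A \<inter> B k. Y i \<omega>)"
        using that by (intro sum.cong) (auto simp: h_def)
      moreover have "(\<Sum>i\<in>A - B k. ?Z \<omega> i) = (\<Sum>i\<in>A - B k. - Y i \<omega>)"
        using that by (intro sum.cong) (auto simp: h_def)
      ultimately show ?thesis by (simp add: sum_negf)
    qed
    have E_eq: "E j (?Z \<omega>) \<longleftrightarrow> E j (?Y \<omega>)" if "j \<le> k" for j \<omega>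
    proof -
      have j: "j < m" using that k by simp
      have "B j \<subseteq> B k \<or> B j \<inter> B k = {}" using B_B[of j k] that k by (cases "j = k") auto
      then have "N (\<Sum>i\<in>B j. ?Z \<omega> i) = N (\<Sum>i\<in>B j. Y i \<omega>)"
      proof
        assume "B j \<subseteq> B k"
        then have eqs: "B j \<inter> B k = B j" "B j - B k = {}" by auto
        show ?thesis unfolding flip[OF B_I[OF j]] eqs by simp
      next
        assume disj: "B j \<inter> B k = {}"
        then have eq: "B j - B k = B j" by auto
        show ?thesis unfolding flip[OF B_I[OF j]] disj eq by (simp add: continuous_normD[OF N])
      qed
      then show ?thesis unfolding E_def sum_Y[OF j] by simp
    qed
    then have G_eq: "G k (?Z \<omega>) \<longleftrightarrow> G k (?Y \<omega>)" for \<omega> by (simp add: G_def)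
    have cover: "T (?Y \<omega>) \<or> T (?Z \<omega>)" if "G k (?Y \<omega>)" for \<omega>
    proof -
      let ?U = "\<Sum>i\<in>I. ?Y \<omega> i" and ?V = "\<Sum>i\<in>I. ?Z \<omega> i"
      have "I \<inter> B k = B k" using B_I[OF k] by auto
      then have V: "?V = (\<Sum>i\<in>B k. Y i \<omega>) - (\<Sum>i\<in>I - B k. Y i \<omega>)" using flip[of I] by simp
      have "?U = (\<Sum>i\<in>I. Y i \<omega>)" by (intro sum.cong) auto
      also have "\<dots> = (\<Sum>i\<in>B k. Y i \<omega>) + (\<Sum>i\<in>I - B k. Y i \<omega>)"
        using sum.Int_Diff[OF I, of _ "B k"] \<open>I \<inter> B k = B k\<close> by simp
      finally have "?U + ?V = 2 *\<^sub>R (\<Sum>i\<in>B k. Y i \<omega>)" using V by (simp add: scaleR_2)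
      moreover have "t < N (\<Sum>i\<in>B k. Y i \<omega>)" using that sum_Y[OF k] by (simp add: G_def E_def)
      ultimately have "2 * t < N (?U + ?V)" by (simp add: continuous_normD[OF N])
      also have "\<dots> \<le> N ?U + N ?V" by (rule continuous_normD[OF N])
      finally show ?thesis unfolding T_def by linarith
    qed
    have "\<P>(\<omega> in M. G k (?Y \<omega>)) \<le> prob ({\<omega> \<in> space M. G k (?Y \<omega>) \<and> T (?Y \<omega>)}
        \<union> {\<omega> \<in> space M. G k (?Z \<omega>) \<and> T (?Z \<omega>)})"
      by (intro finite_measure_mono) (use cover G_eq in auto)
    also have "\<dots> \<le> \<P>(\<omega> in M. G k (?Y \<omega>) \<and> T (?Y \<omega>)) + \<P>(\<omega> in M. G k (?Z \<omega>) \<and> T (?Z \<omega>))"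
      by (rule measure_Un_le) measurable
    also have "\<P>(\<omega> in M. G k (?Z \<omega>) \<and> T (?Z \<omega>)) = \<P>(\<omega> in M. G k (?Y \<omega>) \<and> T (?Y \<omega>))"
      by (rule prob_joint_law_eq[OF indepZ indep, where P = "\<lambda>x. G k x \<and> T x"])
        (simp_all add: law)
    finally show ?thesis by (simp only: mult_2)
  qed
  have pred_E: "Measurable.pred M (\<lambda>\<omega>. E k (?Y \<omega>))" if "k < m" for k
    using measurable_compose[OF Y E[OF that]] by (simp add: comp_def)
  have pred_T: "Measurable.pred M (\<lambda>\<omega>. T (?Y \<omega>))"
    using measurable_compose[OF Y T] by (simp add: comp_def)
  have "\<P>(\<omega> in M. \<exists>k<m. N (\<Sum>i\<in>B k. Y i \<omega>) > t) = \<P>(\<omega> in M. (\<exists>k<m. E k (?Y \<omega>)) \<and> True)"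
    by (intro arg_cong[where f = prob]) (auto simp: E_Y)
  also have "\<dots> = (\<Sum>k<m. \<P>(\<omega> in M. E k (?Y \<omega>) \<and> (\<forall>j<k. \<not> E j (?Y \<omega>)) \<and> True))"
    by (rule sum_prob_first_passage[symmetric]) (use pred_E in auto)
  also have "\<dots> = (\<Sum>k<m. \<P>(\<omega> in M. G k (?Y \<omega>)))"
    by (simp add: G_def)
  also have "\<dots> \<le> (\<Sum>k<m. 2 * \<P>(\<omega> in M. G k (?Y \<omega>) \<and> T (?Y \<omega>)))"
    by (intro sum_mono step) simp
  also have "\<dots> = 2 * (\<Sum>k<m. \<P>(\<omega> in M. E k (?Y \<omega>) \<and> (\<forall>j<k. \<not> E j (?Y \<omega>)) \<and> T (?Y \<omega>)))"
    by (simp only: sum_distrib_left G_def conj_assoc)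
  also have "\<dots> = 2 * \<P>(\<omega> in M. (\<exists>k<m. E k (?Y \<omega>)) \<and> T (?Y \<omega>))"
    using sum_prob_first_passage[of m "\<lambda>k \<omega>. E k (?Y \<omega>)" "\<lambda>\<omega>. T (?Y \<omega>)"] pred_E pred_T by simp
  also have "\<dots> \<le> 2 * \<P>(\<omega> in M. T (?Y \<omega>))"
    using pred_T by (intro mult_left_mono finite_measure_mono) auto
  also have "\<P>(\<omega> in M. T (?Y \<omega>)) = \<P>(\<omega> in M. N (\<Sum>i\<in>I. Y i \<omega>) > t)"
    by (simp only: T_Y)
  finally show ?thesis .
qed

lemma (in prob_space) prob_indep_blocks:
  fixes Y :: "'i \<Rightarrow> 'a \<Rightarrow> 'b::topological_space"
  assumes indep: "indep_vars (\<lambda>_. borel) Y I" and AB: "A \<inter> B = {}" "A \<subseteq> I" "B \<subseteq> I"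
    and G: "Measurable.pred (\<Pi>\<^sub>M i\<in>A. borel) G" and H: "Measurable.pred (\<Pi>\<^sub>M i\<in>B. borel) H"
  shows "\<P>(\<omega> in M. G (\<lambda>i\<in>A. Y i \<omega>) \<and> H (\<lambda>i\<in>B. Y i \<omega>))
    = \<P>(\<omega> in M. G (\<lambda>i\<in>A. Y i \<omega>)) * \<P>(\<omega> in M. H (\<lambda>i\<in>B. Y i \<omega>))"
proof -
  let ?YA = "\<lambda>\<omega>. \<lambda>i\<in>A. Y i \<omega>" and ?YB = "\<lambda>\<omega>. \<lambda>i\<in>B. Y i \<omega>"
  let ?G = "{x \<in> space (\<Pi>\<^sub>M i\<in>A. (borel :: 'b measure)). G x}"
    and ?H = "{x \<in> space (\<Pi>\<^sub>M i\<in>B. (borel :: 'b measure)). H x}"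
  have "indep_var (\<Pi>\<^sub>M i\<in>A. borel) ?YA (\<Pi>\<^sub>M i\<in>B. borel) ?YB"
    by (rule indep_var_restrict[OF indep AB])
  from indep_varD[OF this predE[OF G] predE[OF H]]
  have "prob ((\<lambda>\<omega>. (?YA \<omega>, ?YB \<omega>)) -` (?G \<times> ?H) \<inter> space M)
      = prob (?YA -` ?G \<inter> space M) * prob (?YB -` ?H \<inter> space M)" .
  moreover have "(\<lambda>\<omega>. (?YA \<omega>, ?YB \<omega>)) -` (?G \<times> ?H) \<inter> space M
      = {\<omega> \<in> space M. G (?YA \<omega>) \<and> H (?YB \<omega>)}"
    by (auto simp: space_PiM)
  moreover have "?YA -` ?G \<inter> space M = {\<omega> \<in> space M. G (?YA \<omega>)}" by (auto simp: space_PiM)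
  moreover have "?YB -` ?H \<inter> space M = {\<omega> \<in> space M. H (?YB \<omega>)}" by (auto simp: space_PiM)
  ultimately show ?thesis by simp
qed

text \<open>Let \<open>k\<close> be the first index whose partial sum up to and including term \<open>k\<close> has norm above \<open>t\<close>. If
  no term exceeds \<open>t\<close> but the total sum exceeds \<open>3 * t\<close>, then the terms after \<open>k\<close> must contribute
  more than \<open>t\<close>, because the partial sum before \<open>k\<close> and the term \<open>k\<close> contribute at most \<open>t\<close>
  each. The terms after \<open>k\<close> are independent of the event that \<open>k\<close> is the first passage, and Levy's
  inequality bounds both the probability of a passage and that of a large remainder by
  \<open>2 * P (N S > t)\<close>.\<close>
lemma (in prob_space) hoffmann_jorgensen_inequality:
  fixes Y :: "nat \<Rightarrow> 'a \<Rightarrow> 'b::{real_normed_vector, second_countable_topology}"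
  assumes indep: "indep_vars (\<lambda>_. borel) Y {..<n}"
    and sym: "\<And>i. i < n \<Longrightarrow> symmetric_rv M (Y i)" and N: "continuous_norm N" and "0 \<le> t"
  shows "\<P>(\<omega> in M. N (\<Sum>i<n. Y i \<omega>) > 3 * t)
    \<le> \<P>(\<omega> in M. \<exists>i<n. N (Y i \<omega>) > t) + 4 * (\<P>(\<omega> in M. N (\<Sum>i<n. Y i \<omega>) > t))\<^sup>2"
proof -
  have Y: "Y i \<in> borel_measurable M" if "i < n" for i
    using indep that by (auto simp: indep_vars_def)
  have sym': "symmetric_rv M (Y i)" if "i \<in> {..<n}" for i
    using sym that by simp
  define q where "q = \<P>(\<omega> in M. N (\<Sum>i<n. Y i \<omega>) > t)"
  define E where "E k x \<longleftrightarrow> t < N (\<Sum>i<Suc k. x i)" for k and x :: "nat \<Rightarrow> 'b"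
  define G where "G k x \<longleftrightarrow> E k x \<and> (\<forall>j<k. \<not> E j x)" for k and x :: "nat \<Rightarrow> 'b"
  define H where "H k x \<longleftrightarrow> t < N (\<Sum>i\<in>{Suc k..<n}. x i)" for k and x :: "nat \<Rightarrow> 'b"
  let ?Y = "\<lambda>\<omega> i. Y i \<omega>"
  have comp: "(\<lambda>x. \<Sum>i\<in>J. x i) \<in> borel_measurable (\<Pi>\<^sub>M i\<in>I. (borel :: 'b measure))"
    if "J \<subseteq> I" for I J :: "nat set"
    using that by (intro borel_measurable_sum measurable_component_singleton) auto
  have sum_meas: "(\<lambda>\<omega>. \<Sum>i\<in>J. Y i \<omega>) \<in> borel_measurable M" if "J \<subseteq> {..<n}" for J
    using that by (intro borel_measurable_sum Y) auto
  have predE_M: "Measurable.pred M (\<lambda>\<omega>. E k (?Y \<omega>))" if "k < n" for k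
    unfolding E_def by (intro continuous_norm_pred_greater[OF N] sum_meas) (use that in auto)
  have predH_M: "Measurable.pred M (\<lambda>\<omega>. H k (?Y \<omega>))" for k
    unfolding H_def by (intro continuous_norm_pred_greater[OF N] sum_meas) auto
  have predG_M: "Measurable.pred M (\<lambda>\<omega>. G k (?Y \<omega>))" if "k < n" for k
  proof -
    have "Measurable.pred M (\<lambda>\<omega>. \<forall>j\<in>{..<k}. \<not> E j (?Y \<omega>))"
    proof (intro pred_intros_finite pred_intros_logic)
      show "Measurable.pred M (\<lambda>\<omega>. E j (?Y \<omega>))" if "j \<in> {..<k}" for j
        by (rule predE_M) (use that \<open>k < n\<close> in simp)
    qed simp
    with predE_M[OF that] have "Measurable.pred M (\<lambda>\<omega>. E k (?Y \<omega>) \<and> (\<forall>j\<in>{..<k}. \<not> E j (?Y \<omega>)))"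
      by (rule pred_intros_logic)
    then show ?thesis by (simp add: G_def[abs_def] Ball_def)
  qed
  have rest: "\<P>(\<omega> in M. H k (?Y \<omega>)) \<le> 2 * q" for k
  proof -
    have "\<P>(\<omega> in M. \<exists>j<(1::nat). N (\<Sum>i\<in>{Suc k..<n}. Y i \<omega>) > t) \<le> 2 * q"
      unfolding q_def by (rule levy_inequality[OF _ indep sym' N]) auto
    then show ?thesis by (simp add: H_def)
  qed
  have passage: "(\<Sum>k<n. \<P>(\<omega> in M. G k (?Y \<omega>))) \<le> 2 * q"
  proof -
    have "(\<Sum>k<n. \<P>(\<omega> in M. E k (?Y \<omega>) \<and> (\<forall>j<k. \<not> E j (?Y \<omega>)) \<and> True))
        = \<P>(\<omega> in M. (\<exists>k<n. E k (?Y \<omega>)) \<and> True)"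
      by (rule sum_prob_first_passage) (use predE_M in auto)
    moreover have "\<P>(\<omega> in M. \<exists>k<n. N (\<Sum>i<Suc k. Y i \<omega>) > t) \<le> 2 * q"
      unfolding q_def by (rule levy_inequality[OF _ indep sym' N]) auto
    ultimately show ?thesis by (simp only: G_def E_def simp_thms)
  qed
  have indep_GH: "\<P>(\<omega> in M. G k (?Y \<omega>) \<and> H k (?Y \<omega>))
      = \<P>(\<omega> in M. G k (?Y \<omega>)) * \<P>(\<omega> in M. H k (?Y \<omega>))" if "k < n" for k
  proof -
    let ?A = "{..<Suc k}" and ?B = "{Suc k..<n}"
    have E_A: "E j (\<lambda>i\<in>?A. Y i \<omega>) \<longleftrightarrow> E j (?Y \<omega>)" if "j \<le> k" for j \<omega>
    proof -
      have "(\<Sum>i<Suc j. (\<lambda>i\<in>?A. Y i \<omega>) i) = (\<Sum>i<Suc j. Y i \<omega>)"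
        by (intro sum.cong) (use that in auto)
      then show ?thesis by (simp only: E_def)
    qed
    have G_A: "G k (\<lambda>i\<in>?A. Y i \<omega>) \<longleftrightarrow> G k (?Y \<omega>)" for \<omega>
      unfolding G_def by (simp add: E_A)
    have H_B: "H k (\<lambda>i\<in>?B. Y i \<omega>) \<longleftrightarrow> H k (?Y \<omega>)" for \<omega>
    proof -
      have "(\<Sum>i\<in>?B. (\<lambda>i\<in>?B. Y i \<omega>) i) = (\<Sum>i\<in>?B. Y i \<omega>)"
        by (intro sum.cong) auto
      then show ?thesis by (simp only: H_def)
    qed
    have E: "Measurable.pred (\<Pi>\<^sub>M i\<in>?A. borel) (E j)" if "j \<le> k" for j
      unfolding E_def by (intro continuous_norm_pred_greater[OF N] comp) (use that in auto)
    have "Measurable.pred (\<Pi>\<^sub>M i\<in>?A. borel) (\<lambda>x. \<forall>j\<in>{..<k}. \<not> E j x)"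
    proof (intro pred_intros_finite pred_intros_logic)
      show "Measurable.pred (\<Pi>\<^sub>M i\<in>?A. borel) (\<lambda>x. E j x)" if "j \<in> {..<k}" for j
        by (rule E) (use that in simp)
    qed simp
    with E[OF order_refl]
    have "Measurable.pred (\<Pi>\<^sub>M i\<in>?A. borel) (\<lambda>x. E k x \<and> (\<forall>j\<in>{..<k}. \<not> E j x))"
      by (rule pred_intros_logic)
    then have G: "Measurable.pred (\<Pi>\<^sub>M i\<in>?A. borel) (G k)"
      by (simp add: G_def[abs_def] Ball_def)
    have H: "Measurable.pred (\<Pi>\<^sub>M i\<in>?B. borel) (H k)"
      unfolding H_def by (intro continuous_norm_pred_greater[OF N] comp) auto
    have "\<P>(\<omega> in M. G k (\<lambda>i\<in>?A. Y i \<omega>) \<and> H k (\<lambda>i\<in>?B. Y i \<omega>))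
        = \<P>(\<omega> in M. G k (\<lambda>i\<in>?A. Y i \<omega>)) * \<P>(\<omega> in M. H k (\<lambda>i\<in>?B. Y i \<omega>))"
      by (rule prob_indep_blocks[OF indep _ _ _ G H]) (use that in auto)
    then show ?thesis unfolding G_A H_B .
  qed
  have cover: "\<exists>k<n. G k (?Y \<omega>) \<and> H k (?Y \<omega>)"
    if big: "3 * t < N (\<Sum>i<n. Y i \<omega>)" and small: "\<not> (\<exists>i<n. N (Y i \<omega>) > t)" for \<omega>
  proof -
    have "n \<noteq> 0"
    proof
      assume "n = 0"
      then have "3 * t < 0" using big continuous_normD(2)[OF N] by simp
      then show False using \<open>0 \<le> t\<close> by simp
    qed
    then have "Suc (n - 1) = n" by simp
    moreover have "t < N (\<Sum>i<n. Y i \<omega>)" using big \<open>0 \<le> t\<close> by linarith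
    ultimately have "E (n - 1) (?Y \<omega>)" by (simp only: E_def)
    define k where "k = (LEAST k. E k (?Y \<omega>))"
    have "E k (?Y \<omega>)" unfolding k_def using \<open>E (n - 1) (?Y \<omega>)\<close> by (rule LeastI)
    moreover have before: "\<not> E j (?Y \<omega>)" if "j < k" for j
      using that not_less_Least unfolding k_def by blast
    ultimately have "G k (?Y \<omega>)" by (simp add: G_def)
    have "k \<le> n - 1" unfolding k_def using \<open>E (n - 1) (?Y \<omega>)\<close> by (rule Least_le)
    then have k: "k < n" using \<open>n \<noteq> 0\<close> by simp
    have prev: "N (\<Sum>i<k. Y i \<omega>) \<le> t"
    proof (cases k)
      case 0
      then show ?thesis using \<open>0 \<le> t\<close> continuous_normD(2)[OF N] by simp
    next
      case (Suc j)
      then show ?thesis using before[of j] by (simp only: E_def not_less lessI)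
    qed
    have "{..<n} = {..<Suc k} \<union> {Suc k..<n}" using k by auto
    moreover have "(\<Sum>i\<in>{..<Suc k} \<union> {Suc k..<n}. Y i \<omega>)
        = (\<Sum>i<Suc k. Y i \<omega>) + (\<Sum>i\<in>{Suc k..<n}. Y i \<omega>)"
      by (rule sum.union_disjoint) auto
    ultimately have split: "(\<Sum>i<n. Y i \<omega>) = (\<Sum>i<Suc k. Y i \<omega>) + (\<Sum>i\<in>{Suc k..<n}. Y i \<omega>)"
      by (rule ssubst)
    have "N (\<Sum>i<n. Y i \<omega>) \<le> N (\<Sum>i<Suc k. Y i \<omega>) + N (\<Sum>i\<in>{Suc k..<n}. Y i \<omega>)"
      unfolding split by (rule continuous_normD(4)[OF N])
    also have "N (\<Sum>i<Suc k. Y i \<omega>) \<le> N (\<Sum>i<k. Y i \<omega>) + N (Y k \<omega>)"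
      unfolding sum.lessThan_Suc by (rule continuous_normD(4)[OF N])
    also have "N (Y k \<omega>) \<le> t"
    proof (rule ccontr)
      assume "\<not> N (Y k \<omega>) \<le> t"
      then show False using small k by auto
    qed
    finally have "H k (?Y \<omega>)" using big prev unfolding H_def by linarith
    then show ?thesis using k \<open>G k (?Y \<omega>)\<close> by blast
  qed
  let ?Max = "{\<omega> \<in> space M. \<exists>i<n. N (Y i \<omega>) > t}"
  have Max_meas: "?Max \<in> events"
  proof -
    have "Measurable.pred M (\<lambda>\<omega>. \<exists>i\<in>{..<n}. N (Y i \<omega>) > t)"
    proof (rule pred_intros_finite)
      show "Measurable.pred M (\<lambda>\<omega>. N (Y i \<omega>) > t)" if "i \<in> {..<n}" for i
        using that by (intro continuous_norm_pred_greater[OF N] Y) simp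
    qed simp
    moreover have "(\<exists>i\<in>{..<n}. N (Y i \<omega>) > t) \<longleftrightarrow> (\<exists>i<n. N (Y i \<omega>) > t)" for \<omega>
      by blast
    ultimately have "Measurable.pred M (\<lambda>\<omega>. \<exists>i<n. N (Y i \<omega>) > t)" by (simp only:)
    then show ?thesis by (rule predE)
  qed
  have GH_meas: "{\<omega> \<in> space M. G k (?Y \<omega>) \<and> H k (?Y \<omega>)} \<in> events" if "k \<in> {..<n}" for k
  proof (rule predE)
    from that have "k < n" by simp
    from predG_M[OF this] predH_M[of k]
    show "Measurable.pred M (\<lambda>\<omega>. G k (?Y \<omega>) \<and> H k (?Y \<omega>))"
      by (rule pred_intros_logic)
  qed
  have "\<P>(\<omega> in M. N (\<Sum>i<n. Y i \<omega>) > 3 * t)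
      \<le> prob (?Max \<union> (\<Union>k\<in>{..<n}. {\<omega> \<in> space M. G k (?Y \<omega>) \<and> H k (?Y \<omega>)}))"
  proof (rule finite_measure_mono)
    show "{\<omega> \<in> space M. N (\<Sum>i<n. Y i \<omega>) > 3 * t}
        \<subseteq> ?Max \<union> (\<Union>k\<in>{..<n}. {\<omega> \<in> space M. G k (?Y \<omega>) \<and> H k (?Y \<omega>)})"
    proof
      fix \<omega> assume "\<omega> \<in> {\<omega> \<in> space M. N (\<Sum>i<n. Y i \<omega>) > 3 * t}"
      then have \<omega>: "\<omega> \<in> space M" "3 * t < N (\<Sum>i<n. Y i \<omega>)" by simp_all
      show "\<omega> \<in> ?Max \<union> (\<Union>k\<in>{..<n}. {\<omega> \<in> space M. G k (?Y \<omega>) \<and> H k (?Y \<omega>)})"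
      proof (cases "\<exists>i<n. N (Y i \<omega>) > t")
        case True
        then show ?thesis using \<omega>(1) by blast
      next
        case False
        then obtain k where "k < n" "G k (?Y \<omega>) \<and> H k (?Y \<omega>)" using cover[OF \<omega>(2)] by blast
        then show ?thesis using \<omega>(1) by blast
      qed
    qed
    show "?Max \<union> (\<Union>k\<in>{..<n}. {\<omega> \<in> space M. G k (?Y \<omega>) \<and> H k (?Y \<omega>)}) \<in> events"
      by (rule sets.Un[OF Max_meas sets.finite_UN[OF _ GH_meas]]) simp_all
  qed
  also have "\<dots> \<le> prob ?Max + prob (\<Union>k\<in>{..<n}. {\<omega> \<in> space M. G k (?Y \<omega>) \<and> H k (?Y \<omega>)})"
    by (rule measure_Un_le[OF Max_meas sets.finite_UN[OF _ GH_meas]]) simp_all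
  also have "prob (\<Union>k\<in>{..<n}. {\<omega> \<in> space M. G k (?Y \<omega>) \<and> H k (?Y \<omega>)})
      \<le> (\<Sum>k<n. \<P>(\<omega> in M. G k (?Y \<omega>) \<and> H k (?Y \<omega>)))"
    by (rule finite_measure_subadditive_finite[OF _ image_subsetI[OF GH_meas]]) simp_all
  also have "\<dots> = (\<Sum>k<n. \<P>(\<omega> in M. G k (?Y \<omega>)) * \<P>(\<omega> in M. H k (?Y \<omega>)))"
    by (rule sum.cong[OF refl indep_GH]) simp
  also have "\<dots> \<le> (\<Sum>k<n. \<P>(\<omega> in M. G k (?Y \<omega>)) * (2 * q))"
    by (rule sum_mono[OF mult_left_mono[OF rest measure_nonneg]])
  also have "\<dots> \<le> (2 * q) * (2 * q)"
    unfolding sum_distrib_right[symmetric]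
    by (rule mult_right_mono[OF passage]) (simp add: q_def)
  also have "(2 * q) * (2 * q) = 4 * q\<^sup>2" by (simp add: power2_eq_square)
  finally show ?thesis unfolding q_def by linarith
qed

section \<open>The weak Borell inequality for sums\<close>

lemma symmetric_rv_scaleR:
  fixes X :: "'a \<Rightarrow> 'b::{real_normed_vector, second_countable_topology}"
  assumes "symmetric_rv M X"
  shows "symmetric_rv M (\<lambda>\<omega>. c *\<^sub>R X \<omega>)"
proof -
  have [measurable]: "X \<in> borel_measurable M" using assms by (simp add: symmetric_rv_def)
  have [measurable]: "(\<lambda>x::'b. c *\<^sub>R x) \<in> borel_measurable borel"
    by (intro borel_measurable_continuous_onI continuous_intros)
  have "distr M borel (\<lambda>\<omega>. c *\<^sub>R X \<omega>) = distr (distr M borel X) borel (\<lambda>x. c *\<^sub>R x)"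
    by (simp add: distr_distr comp_def)
  also have "distr M borel X = distr M borel (\<lambda>\<omega>. - X \<omega>)"
    using assms by (simp add: symmetric_rv_def)
  also have "distr \<dots> borel (\<lambda>x. c *\<^sub>R x) = distr M borel (\<lambda>\<omega>. - (c *\<^sub>R X \<omega>))"
    by (simp add: distr_distr comp_def)
  finally show ?thesis by (simp add: symmetric_rv_def)
qed

text \<open>For a nonzero scalar, rescaling the vector amounts to rescaling the norm, and the inequality holds
  for all continuous norms with the same constants.\<close>
lemma weak_borell_scaleR:
  fixes X :: "'a \<Rightarrow> 'b::real_normed_vector"
  assumes "weak_borell M X C \<delta> \<theta>" "continuous_norm N" "1 \<le> l"
    and small: "\<P>(\<omega> in M. N (c *\<^sub>R X \<omega>) > 1) < \<theta>"
  shows "\<P>(\<omega> in M. N (c *\<^sub>R X \<omega>) > l) \<le> C * l powr (-\<delta>) * \<P>(\<omega> in M. N (c *\<^sub>R X \<omega>) > 1)"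
proof (cases "c = 0")
  case True
  then show ?thesis using assms(3) continuous_normD(2)[OF assms(2)] by simp
next
  case False
  have N: "continuous_norm (\<lambda>x. \<bar>c\<bar> * N x)"
    by (rule continuous_norm_scale[OF assms(2)]) (use False in simp)
  have eq: "N (c *\<^sub>R X \<omega>) = \<bar>c\<bar> * N (X \<omega>)" for \<omega>
    by (rule continuous_normD(3)[OF assms(2)])
  show ?thesis
    using assms(1,3) N small unfolding weak_borell_def eq by blast
qed

text \<open>By independence the first factor is the product of the \<open>1 - P (N (Y i) > t) \<le> exp (- P (N (Y i) > t))\<close>.
  Thus a small probability of some large term forces a small sum of the individual probabilities.\<close>
lemma (in prob_space) prob_none_times_one_plus_sum_prob_le:
  fixes Y :: "nat \<Rightarrow> 'a \<Rightarrow> 'b::{real_normed_vector, second_countable_topology}"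
  assumes indep: "indep_vars (\<lambda>_. borel) Y {..<n}" and N: "continuous_norm N"
  shows "(1 - \<P>(\<omega> in M. \<exists>i<n. N (Y i \<omega>) > t)) * (1 + (\<Sum>i<n. \<P>(\<omega> in M. N (Y i \<omega>) > t))) \<le> 1"
proof (cases "n = 0")
  case True
  then show ?thesis by simp
next
  case False
  have Y: "Y i \<in> borel_measurable M" if "i < n" for i
    using indep that by (auto simp: indep_vars_def)
  let ?A = "\<lambda>i. {\<omega> \<in> space M. N (Y i \<omega>) > t}"
  have A: "?A i \<in> events" if "i < n" for i
    by (rule predE[OF continuous_norm_pred_greater[OF N Y[OF that]]])
  have UA: "(\<Union>i\<in>{..<n}. ?A i) \<in> events"
    by (rule sets.finite_UN) (use A in simp_all)
  have ball: "{x. N x \<le> t} \<in> sets borel"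
  proof -
    note [measurable] = continuous_norm_measurable[OF N]
    show ?thesis by measurable
  qed
  let ?s = "\<Sum>i<n. prob (?A i)"
  have ex: "{\<omega> \<in> space M. \<exists>i<n. N (Y i \<omega>) > t} = (\<Union>i\<in>{..<n}. ?A i)"
    by blast
  have "1 - prob (\<Union>i\<in>{..<n}. ?A i) = prob (space M - (\<Union>i\<in>{..<n}. ?A i))"
    by (rule prob_compl[OF UA, symmetric])
  also have "space M - (\<Union>i\<in>{..<n}. ?A i) = (\<Inter>i\<in>{..<n}. Y i -` {x. N x \<le> t} \<inter> space M)"
  proof (intro set_eqI iffI)
    fix \<omega> assume "\<omega> \<in> (\<Inter>i\<in>{..<n}. Y i -` {x. N x \<le> t} \<inter> space M)"
    then have *: "\<omega> \<in> Y i -` {x. N x \<le> t} \<inter> space M" if "i < n" for i using that by blast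
    then have "\<omega> \<in> space M" using False by blast
    moreover have "\<omega> \<notin> ?A i" if "i < n" for i using *[OF that] by simp
    ultimately show "\<omega> \<in> space M - (\<Union>i\<in>{..<n}. ?A i)" by blast
  qed (auto simp: not_less)
  also have "prob \<dots> = (\<Prod>i<n. prob (Y i -` {x. N x \<le> t} \<inter> space M))"
    by (rule indep_varsD[OF indep]) (use False ball in auto)
  also have "\<dots> = (\<Prod>i<n. 1 - prob (?A i))"
  proof (rule prod.cong[OF refl])
    fix i assume "i \<in> {..<n}"
    then have "i < n" by simp
    have "Y i -` {x. N x \<le> t} \<inter> space M = space M - ?A i" by (auto simp: not_less)
    then show "prob (Y i -` {x. N x \<le> t} \<inter> space M) = 1 - prob (?A i)"
      by (simp only: prob_compl[OF A[OF \<open>i < n\<close>]])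
  qed
  also have "\<dots> \<le> (\<Prod>i<n. exp (- prob (?A i)))"
  proof (rule prod_mono)
    fix i assume "i \<in> {..<n}"
    show "0 \<le> 1 - prob (?A i) \<and> 1 - prob (?A i) \<le> exp (- prob (?A i))"
      using exp_ge_add_one_self[of "- prob (?A i)"] by simp
  qed
  also have "\<dots> = exp (- ?s)"
    by (simp add: exp_sum sum_negf[symmetric])
  finally have "1 - prob (\<Union>i\<in>{..<n}. ?A i) \<le> exp (- ?s)" .
  moreover have "1 + ?s \<le> exp ?s" by (rule exp_ge_add_one_self)
  moreover have "0 \<le> 1 + ?s" by (intro add_nonneg_nonneg sum_nonneg) simp_all
  ultimately have "(1 - prob (\<Union>i\<in>{..<n}. ?A i)) * (1 + ?s) \<le> exp (- ?s) * exp ?s"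
    by (intro mult_mono) simp_all
  also have "\<dots> = 1" by (simp add: exp_minus)
  finally show ?thesis unfolding ex .
qed

text \<open>The sum inherits the decay rate of its terms. Put \<open>r = 3 powr (-\<delta>)\<close>. The probability that some
  term exceeds \<open>3 ^ k\<close> is at most \<open>21 / 10 * C * r ^ k * p\<close>, by Levy's inequality,
  independence, and the weak Borell inequality for the terms. In the Hoffmann-Jorgensen inequality at \<open>3 ^ k\<close> the quadratic term
  contributes at most \<open>3 / 8 * C * r ^ k * p\<close>: one of its two factors of order \<open>p\<close> absorbs all constants,
  which is where \<open>96 * C * 9 powr \<delta> * p \<le> 1\<close> enters. The total stays below \<open>3 * C * r ^ k * p\<close>, the
  bound claimed for \<open>3 ^ Suc k\<close>.\<close>
lemma (in prob_space) sum_tail_decay: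
  fixes Y :: "nat \<Rightarrow> 'a \<Rightarrow> 'b::{real_normed_vector, second_countable_topology}"
  assumes indep: "indep_vars (\<lambda>_. borel) Y {..<n}"
    and sym: "\<And>i. i < n \<Longrightarrow> symmetric_rv M (Y i)" and N: "continuous_norm N"
    and "1 \<le> C" "0 \<le> \<delta>"
    and wb: "\<And>i l. i < n \<Longrightarrow> \<P>(\<omega> in M. N (Y i \<omega>) > 1) < \<theta> \<Longrightarrow> 1 \<le> l \<Longrightarrow>
      \<P>(\<omega> in M. N (Y i \<omega>) > l) \<le> C * l powr (-\<delta>) * \<P>(\<omega> in M. N (Y i \<omega>) > 1)"
    and p_def: "p = \<P>(\<omega> in M. N (\<Sum>i<n. Y i \<omega>) > 1)"
    and p_\<theta>: "2 * p < \<theta>" and p_small: "96 * C * 9 powr \<delta> * p \<le> 1"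
  shows "\<P>(\<omega> in M. N (\<Sum>i<n. Y i \<omega>) > 3 ^ k) \<le> 3 * C * 3 powr \<delta> * (3 powr (-\<delta>)) ^ k * p"
proof -
  have Y: "Y i \<in> borel_measurable M" if "i < n" for i
    using indep that by (auto simp: indep_vars_def)
  have A: "{\<omega> \<in> space M. N (Y i \<omega>) > t} \<in> events" if "i < n" for i t
    by (rule predE[OF continuous_norm_pred_greater[OF N Y[OF that]]])
  have p: "0 \<le> p" by (simp add: p_def)
  have "1 * 1 \<le> C * 9 powr \<delta>"
    using \<open>1 \<le> C\<close> \<open>0 \<le> \<delta>\<close> by (intro mult_mono ge_one_powr_ge_zero) auto
  then have "1 * p \<le> C * 9 powr \<delta> * p" using p by (intro mult_right_mono) auto
  then have p_96: "p \<le> 1 / 96" using p_small by simp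
  define r where "r = (3::real) powr (-\<delta>)"
  define R where "R = (3::real) powr \<delta>"
  have rR: "r * R = 1" by (simp add: r_def R_def flip: powr_add)
  have RR: "R * R = 9 powr \<delta>" by (simp add: R_def flip: powr_mult)
  have R: "1 \<le> R" unfolding R_def using \<open>0 \<le> \<delta>\<close> by (intro ge_one_powr_ge_zero) auto
  have "0 < r" by (simp add: r_def)
  then have "r * 1 \<le> r * R" using R by (intro mult_left_mono) auto
  then have r: "0 < r" "r \<le> 1" using \<open>0 < r\<close> rR by simp_all
  define m where "m t = \<P>(\<omega> in M. \<exists>i<n. N (Y i \<omega>) > t)" for t
  define s where "s = (\<Sum>i<n. \<P>(\<omega> in M. N (Y i \<omega>) > 1))"
  have m: "m 1 \<le> 2 * p"
  proof -
    have "\<P>(\<omega> in M. \<exists>k<n. N (\<Sum>i\<in>{k}. Y i \<omega>) > 1) \<le> 2 * p"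
      unfolding p_def by (rule levy_inequality[OF _ indep _ N]) (use sym in auto)
    then show ?thesis by (simp add: m_def)
  qed
  have m_meas: "{\<omega> \<in> space M. \<exists>i<n. N (Y i \<omega>) > t} = (\<Union>i\<in>{..<n}. {\<omega> \<in> space M. N (Y i \<omega>) > t})" for t
    by blast
  have UA: "(\<Union>i\<in>{..<n}. {\<omega> \<in> space M. N (Y i \<omega>) > t}) \<in> events" for t
    by (rule sets.finite_UN) (use A in simp_all)
  have p_i: "\<P>(\<omega> in M. N (Y i \<omega>) > 1) < \<theta>" if "i < n" for i
  proof -
    have "\<P>(\<omega> in M. N (Y i \<omega>) > 1) \<le> m 1"
      unfolding m_def m_meas by (rule finite_measure_mono[OF _ UA]) (use that in blast)
    then show ?thesis using m p_\<theta> by linarith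
  qed
  have s: "s \<le> 21 / 10 * p"
  proof -
    have s0: "0 \<le> s" unfolding s_def by (intro sum_nonneg) simp
    have "(1 - 2 * p) * (1 + s) \<le> (1 - m 1) * (1 + s)"
      using m s0 by (intro mult_right_mono) auto
    also have "\<dots> \<le> 1"
      unfolding m_def s_def by (rule prob_none_times_one_plus_sum_prob_le[OF indep N])
    finally have "s * (1 - 2 * p) \<le> 2 * p" by (simp add: algebra_simps)
    moreover have "s * (20 / 21) \<le> s * (1 - 2 * p)"
      using s0 p_96 by (intro mult_left_mono) auto
    ultimately show ?thesis by linarith
  qed
  have m_tail: "m t \<le> C * t powr (-\<delta>) * s" if "1 \<le> t" for t
  proof -
    have "m t \<le> (\<Sum>i<n. \<P>(\<omega> in M. N (Y i \<omega>) > t))"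
      unfolding m_def m_meas
      by (rule finite_measure_subadditive_finite) (use A in auto)
    also have "\<dots> \<le> (\<Sum>i<n. C * t powr (-\<delta>) * \<P>(\<omega> in M. N (Y i \<omega>) > 1))"
      by (rule sum_mono) (use wb p_i that in simp)
    finally show ?thesis by (simp only: s_def sum_distrib_left)
  qed
  define q where "q k = \<P>(\<omega> in M. N (\<Sum>i<n. Y i \<omega>) > 3 ^ k)" for k :: nat
  have "q k \<le> 3 * C * R * r ^ k * p"
  proof (induction k)
    case 0
    have "1 * 1 \<le> (3 * C) * R" using R \<open>1 \<le> C\<close> by (intro mult_mono) auto
    then have "1 * p \<le> 3 * C * R * p" using p by (intro mult_right_mono) auto
    moreover have "q 0 = p" by (simp add: q_def p_def)
    ultimately show ?case by simp
  next
    case (Suc k)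
    have q0: "0 \<le> q k" by (simp add: q_def)
    have rk: "0 \<le> r ^ k" "r ^ k \<le> 1" using r by (auto intro: power_le_one)
    have pow: "(3 ^ k) powr (-\<delta>) = r ^ k"
      by (simp add: r_def powr_powr mult.commute flip: powr_realpow)
    have "q (Suc k) \<le> m (3 ^ k) + 4 * (q k)\<^sup>2"
      using hoffmann_jorgensen_inequality[OF indep sym N, of "3 ^ k"]
      by (simp add: q_def m_def)
    also have "m (3 ^ k) \<le> C * r ^ k * (21 / 10 * p)"
    proof -
      have "m (3 ^ k) \<le> C * r ^ k * s"
        using m_tail[of "3 ^ k"] by (simp add: pow)
      also have "\<dots> \<le> C * r ^ k * (21 / 10 * p)"
        using s rk \<open>1 \<le> C\<close> by (intro mult_left_mono) auto
      finally show ?thesis .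
    qed
    also have "4 * (q k)\<^sup>2 \<le> C * r ^ k * (3 / 8 * p)"
    proof -
      have "(q k)\<^sup>2 \<le> (3 * C * R * r ^ k * p)\<^sup>2"
        using Suc.IH q0 by (intro power_mono)
      also have "\<dots> = 9 * (C * 9 powr \<delta> * p) * (C * r ^ k * p) * r ^ k"
        unfolding RR[symmetric] by (simp add: power2_eq_square algebra_simps)
      also have "\<dots> \<le> 9 * (1 / 96) * (C * r ^ k * p) * 1"
        using p_small rk p \<open>1 \<le> C\<close> by (intro mult_mono) auto
      finally show ?thesis by simp
    qed
    finally have "q (Suc k) \<le> C * r ^ k * p * (99 / 40)" by (simp add: algebra_simps)
    also have "\<dots> \<le> C * r ^ k * p * 3"
      using rk p \<open>1 \<le> C\<close> by (intro mult_left_mono) auto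
    also have "\<dots> = 3 * C * R * r ^ Suc k * p"
      using rR by (simp add: algebra_simps)
    finally show ?case .
  qed
  then show ?thesis by (simp only: q_def r_def R_def)
qed

section \<open>The excess over the level one\<close>

text \<open>The part of \<open>x\<close> above \<open>1\<close> is cut at the powers of three; the piece from \<open>3 ^ k\<close> to \<open>3 ^ Suc k\<close> has
  length \<open>2 * 3 ^ k\<close> and is nonempty only if \<open>x > 3 ^ k\<close>. This replaces the integral of the tail by a
  sum over the levels at which \<open>sum_tail_decay\<close> controls it.\<close>
lemma min_le_sum_powers_3:
  fixes x :: real
  shows "min x (3 ^ m) - 1 \<le> (\<Sum>k<m. 2 * 3 ^ k * (if x > 3 ^ k then 1 else 0))"
proof (induction m)
  case (Suc m)
  have "min x (3 ^ Suc m) \<le> min x (3 ^ m) + 2 * 3 ^ m * (if x > 3 ^ m then 1 else 0)"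
    by (auto simp: min_def)
  then show ?case using Suc.IH by simp
qed simp

lemma (in prob_space) nn_integral_excess_le_suminf:
  fixes Z :: "'a \<Rightarrow> real"
  assumes [measurable]: "Z \<in> borel_measurable M"
  shows "(\<integral>\<^sup>+\<omega>. ennreal (max 0 (Z \<omega> - 1)) \<partial>M) \<le> (\<Sum>k. ennreal (2 * 3 ^ k * \<P>(\<omega> in M. Z \<omega> > 3 ^ k)))"
proof -
  let ?f = "\<lambda>k \<omega>. ennreal (2 * 3 ^ k) * indicator {\<omega> \<in> space M. Z \<omega> > 3 ^ k} \<omega>"
  have "(\<integral>\<^sup>+\<omega>. ennreal (max 0 (Z \<omega> - 1)) \<partial>M) \<le> (\<integral>\<^sup>+\<omega>. (\<Sum>k. ?f k \<omega>) \<partial>M)"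
  proof (rule nn_integral_mono)
    fix \<omega> assume \<omega>: "\<omega> \<in> space M"
    obtain m where m: "Z \<omega> < 3 ^ m" using real_arch_pow[of 3 "Z \<omega>"] by auto
    have nonneg: "0 \<le> (\<Sum>k<m. 2 * 3 ^ k * (if Z \<omega> > 3 ^ k then 1 else 0 :: real))"
      by (intro sum_nonneg) simp
    then have "max 0 (Z \<omega> - 1) \<le> (\<Sum>k<m. 2 * 3 ^ k * (if Z \<omega> > 3 ^ k then 1 else 0))"
      using min_le_sum_powers_3[of "Z \<omega>" m] m by simp
    then have "ennreal (max 0 (Z \<omega> - 1))
        \<le> ennreal (\<Sum>k<m. 2 * 3 ^ k * (if Z \<omega> > 3 ^ k then 1 else 0))"
      by (rule ennreal_leI)
    also have "\<dots> = (\<Sum>k<m. ennreal (2 * 3 ^ k * (if Z \<omega> > 3 ^ k then 1 else 0)))"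
      by (rule sum_ennreal[symmetric]) simp
    also have "\<dots> = (\<Sum>k<m. ?f k \<omega>)"
      using \<omega> by (intro sum.cong refl) (simp add: indicator_def)
    also have "\<dots> \<le> (\<Sum>k. ?f k \<omega>)"
      by (rule sum_le_suminf) simp_all
    finally show "ennreal (max 0 (Z \<omega> - 1)) \<le> (\<Sum>k. ?f k \<omega>)" .
  qed
  also have "\<dots> = (\<Sum>k. \<integral>\<^sup>+\<omega>. ?f k \<omega> \<partial>M)"
    by (rule nn_integral_suminf) measurable
  also have "(\<lambda>k. \<integral>\<^sup>+\<omega>. ?f k \<omega> \<partial>M) = (\<lambda>k. ennreal (2 * 3 ^ k * \<P>(\<omega> in M. Z \<omega> > 3 ^ k)))"
  proof
    fix k
    have "(\<integral>\<^sup>+\<omega>. ?f k \<omega> \<partial>M) = ennreal (2 * 3 ^ k) * emeasure M {\<omega> \<in> space M. Z \<omega> > 3 ^ k}"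
      by (rule nn_integral_cmult_indicator) measurable
    then show "(\<integral>\<^sup>+\<omega>. ?f k \<omega> \<partial>M) = ennreal (2 * 3 ^ k * \<P>(\<omega> in M. Z \<omega> > 3 ^ k))"
      by (simp add: emeasure_eq_measure ennreal_mult)
  qed
  finally show ?thesis .
qed

lemma (in prob_space) nn_integral_excess_le:
  fixes Z :: "'a \<Rightarrow> real"
  assumes "Z \<in> borel_measurable M" and "0 \<le> D" "0 < r" "3 * r < 1"
    and tail: "\<And>k. \<P>(\<omega> in M. Z \<omega> > 3 ^ k) \<le> D * r ^ k"
  shows "(\<integral>\<^sup>+\<omega>. ennreal (max 0 (Z \<omega> - 1)) \<partial>M) \<le> ennreal (2 * D / (1 - 3 * r))"
proof -
  have "(\<integral>\<^sup>+\<omega>. ennreal (max 0 (Z \<omega> - 1)) \<partial>M) \<le> (\<Sum>k. ennreal (2 * 3 ^ k * \<P>(\<omega> in M. Z \<omega> > 3 ^ k)))"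
    by (rule nn_integral_excess_le_suminf[OF assms(1)])
  also have "\<dots> \<le> (\<Sum>k. ennreal (2 * D * (3 * r) ^ k))"
  proof (rule suminf_le)
    fix k
    have "2 * 3 ^ k * \<P>(\<omega> in M. Z \<omega> > 3 ^ k) \<le> 2 * 3 ^ k * (D * r ^ k)"
      by (intro mult_left_mono tail) simp
    also have "\<dots> = 2 * D * (3 * r) ^ k" by (simp add: power_mult_distrib)
    finally show "ennreal (2 * 3 ^ k * \<P>(\<omega> in M. Z \<omega> > 3 ^ k)) \<le> ennreal (2 * D * (3 * r) ^ k)"
      by (rule ennreal_leI)
  qed simp_all
  also have "\<dots> = ennreal (2 * D / (1 - 3 * r))"
  proof (rule suminf_ennreal_eq)
    show "0 \<le> 2 * D * (3 * r) ^ k" for k using assms(2,3) by simp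
    have "(\<lambda>k. (3 * r) ^ k) sums (1 / (1 - 3 * r))"
      using assms(3,4) by (intro geometric_sums) simp
    from sums_mult[OF this, of "2 * D"]
    show "(\<lambda>k. 2 * D * (3 * r) ^ k) sums (2 * D / (1 - 3 * r))" by simp
  qed
  finally show ?thesis .
qed

text \<open>A family reindexed along an injection is the family of its restrictions to disjoint singletons.\<close>
lemma (in prob_space) indep_vars_reindex_inj:
  assumes indep: "indep_vars (\<lambda>_. S) Y I" and g: "inj_on g J" "g ` J \<subseteq> I"
  shows "indep_vars (\<lambda>_. S) (\<lambda>j. Y (g j)) J"
proof -
  have "indep_vars (\<lambda>j. \<Pi>\<^sub>M i\<in>{g j}. S) (\<lambda>j \<omega>. \<lambda>i\<in>{g j}. Y i \<omega>) J"
    using g by (intro indep_vars_restrict[OF indep]) (auto simp: disjoint_family_on_def inj_on_def)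
  then have "indep_vars (\<lambda>_. S) (\<lambda>j \<omega>. (\<lambda>i\<in>{g j}. Y i \<omega>) (g j)) J"
    by (rule indep_vars_compose2) (rule measurable_component_singleton, simp)
  then show ?thesis by simp
qed

text \<open>The mean excess over \<open>1\<close> is a convex function of the coefficients, since the excess is a convex
  function of the sum, and it is invariant under permutations of them, since the vectors are
  independent and identically distributed. Its values are extended nonnegative reals because finiteness for
  \<open>a\<close> becomes known only through the comparison.\<close>
lemma (in prob_space) nn_integral_excess_mono_majorised:
  fixes X :: "nat \<Rightarrow> 'a \<Rightarrow> 'b::{real_normed_vector, second_countable_topology}"
  assumes indep: "indep_vars (\<lambda>_. borel) X {..<length a}"
    and iid: "\<And>i j. distr M borel (X i) = distr M borel (X j)"
    and N: "continuous_norm N" and maj: "majorised a b"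
  shows "(\<integral>\<^sup>+\<omega>. ennreal (max 0 (N (\<Sum>i<length a. (a ! i) *\<^sub>R X i \<omega>) - 1)) \<partial>M)
    \<le> (\<integral>\<^sup>+\<omega>. ennreal (max 0 (N (\<Sum>i<length a. (b ! i) *\<^sub>R X i \<omega>) - 1)) \<partial>M)"
proof -
  let ?n = "length a"
  have X: "X i \<in> borel_measurable M" if "i < ?n" for i
    using indep that by (auto simp: indep_vars_def)
  note [measurable] = continuous_norm_measurable[OF N]
  define f where "f c x = ennreal (max 0 (N (\<Sum>i<?n. c i *\<^sub>R x i) - 1))"
    for c :: "nat \<Rightarrow> real" and x :: "nat \<Rightarrow> 'b"
  define F where "F c = (\<integral>\<^sup>+\<omega>. f c (\<lambda>i. X i \<omega>) \<partial>M)" for c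
  have f_meas: "f c \<in> borel_measurable (\<Pi>\<^sub>M i\<in>{..<?n}. borel)" for c
  proof -
    have [measurable]: "(\<lambda>x. \<Sum>i<?n. c i *\<^sub>R x i) \<in> borel_measurable (\<Pi>\<^sub>M i\<in>{..<?n}. (borel :: 'b measure))"
      by (intro borel_measurable_sum borel_measurable_scaleR borel_measurable_const
          measurable_component_singleton)
    show ?thesis unfolding f_def[abs_def] by measurable
  qed
  have fX_meas: "(\<lambda>\<omega>. f c (\<lambda>i. X i \<omega>)) \<in> borel_measurable M" for c
  proof -
    have [measurable]: "(\<lambda>\<omega>. \<Sum>i<?n. c i *\<^sub>R X i \<omega>) \<in> borel_measurable M"
      by (intro borel_measurable_sum borel_measurable_scaleR borel_measurable_const X) simp
    show ?thesis unfolding f_def by measurable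
  qed
  have f_restrict: "f c (\<lambda>i\<in>{..<?n}. x i) = f c x" for c x
  proof -
    have "(\<Sum>i<?n. c i *\<^sub>R (\<lambda>i\<in>{..<?n}. x i) i) = (\<Sum>i<?n. c i *\<^sub>R x i)"
      by (intro sum.cong) auto
    then show ?thesis by (simp only: f_def)
  qed
  have F_law: "(\<integral>\<^sup>+\<omega>. f c (\<lambda>i. Z i \<omega>) \<partial>M)
      = (\<integral>\<^sup>+x. f c x \<partial>distr M (\<Pi>\<^sub>M i\<in>{..<?n}. borel) (\<lambda>\<omega>. \<lambda>i\<in>{..<?n}. Z i \<omega>))"
    if "indep_vars (\<lambda>_. borel) Z {..<?n}" for c Z
  proof -
    have "(\<lambda>\<omega>. \<lambda>i\<in>{..<?n}. Z i \<omega>) \<in> measurable M (\<Pi>\<^sub>M i\<in>{..<?n}. borel)"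
      using that by (intro measurable_restrict) (auto simp: indep_vars_def)
    then show ?thesis
      using f_meas by (subst nn_integral_distr) (simp_all add: f_restrict)
  qed
  have perm: "F (\<lambda>i. c (p i)) = F c" if p: "p permutes {..<?n}" for p c
  proof -
    let ?q = "inv p"
    have q: "?q permutes {..<?n}" using p by (rule permutes_inv)
    have "indep_vars (\<lambda>_. borel) (\<lambda>i. X (?q i)) {..<?n}"
      by (rule indep_vars_reindex_inj[OF indep permutes_inj_on[OF q]])
        (simp only: permutes_image[OF q] subset_refl)
    note indep_q = this
    have "f (\<lambda>i. c (p i)) (\<lambda>i. X i \<omega>) = f c (\<lambda>i. X (?q i) \<omega>)" for \<omega>
    proof -
      have "(\<Sum>i<?n. c i *\<^sub>R X (?q i) \<omega>) = (\<Sum>i<?n. c (p i) *\<^sub>R X (?q (p i)) \<omega>)"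
        by (rule sum.permute[OF p, unfolded comp_def])
      also have "\<dots> = (\<Sum>i<?n. c (p i) *\<^sub>R X i \<omega>)"
        by (simp only: permutes_inverses(2)[OF p])
      finally show ?thesis by (simp only: f_def)
    qed
    then have "F (\<lambda>i. c (p i)) = (\<integral>\<^sup>+\<omega>. f c (\<lambda>i. X (?q i) \<omega>) \<partial>M)"
      by (simp only: F_def)
    also have "\<dots> = F c"
      unfolding F_def F_law[OF indep_q] F_law[OF indep]
      by (subst joint_law_eq[OF indep_q indep iid]) (rule refl)
    finally show ?thesis .
  qed
  have conv: "F (\<lambda>i. (1 - s) * c i + s * d i) \<le> ennreal (1 - s) * F c + ennreal s * F d"
    if s: "0 \<le> s" "s \<le> 1" for c d s
  proof -
    have "f (\<lambda>i. (1 - s) * c i + s * d i) x \<le> ennreal (1 - s) * f c x + ennreal s * f d x" for x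
    proof -
      let ?u = "\<Sum>i<?n. c i *\<^sub>R x i" and ?v = "\<Sum>i<?n. d i *\<^sub>R x i"
      have "(\<Sum>i<?n. ((1 - s) * c i + s * d i) *\<^sub>R x i) = (1 - s) *\<^sub>R ?u + s *\<^sub>R ?v"
        by (simp add: scaleR_add_left sum.distrib scaleR_sum_right)
      then have "N (\<Sum>i<?n. ((1 - s) * c i + s * d i) *\<^sub>R x i) \<le> N ((1 - s) *\<^sub>R ?u) + N (s *\<^sub>R ?v)"
        by (simp only: continuous_normD(4)[OF N])
      also have "\<dots> = (1 - s) * N ?u + s * N ?v"
        using s by (simp add: continuous_normD(3)[OF N])
      finally have "N (\<Sum>i<?n. ((1 - s) * c i + s * d i) *\<^sub>R x i) - 1
          \<le> (1 - s) * (N ?u - 1) + s * (N ?v - 1)"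
        by (simp add: algebra_simps)
      also have "\<dots> \<le> (1 - s) * max 0 (N ?u - 1) + s * max 0 (N ?v - 1)"
        using s by (intro add_mono mult_left_mono) auto
      finally have "max 0 (N (\<Sum>i<?n. ((1 - s) * c i + s * d i) *\<^sub>R x i) - 1)
          \<le> (1 - s) * max 0 (N ?u - 1) + s * max 0 (N ?v - 1)"
        using s by simp
      then have "f (\<lambda>i. (1 - s) * c i + s * d i) x
          \<le> ennreal ((1 - s) * max 0 (N ?u - 1) + s * max 0 (N ?v - 1))"
        unfolding f_def by (rule ennreal_leI)
      also have "\<dots> = ennreal (1 - s) * f c x + ennreal s * f d x"
        using s by (simp add: f_def ennreal_plus ennreal_mult)
      finally show ?thesis .
    qed
    then have "F (\<lambda>i. (1 - s) * c i + s * d i)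
        \<le> (\<integral>\<^sup>+\<omega>. ennreal (1 - s) * f c (\<lambda>i. X i \<omega>) + ennreal s * f d (\<lambda>i. X i \<omega>) \<partial>M)"
      unfolding F_def by (intro nn_integral_mono)
    also have "\<dots> = ennreal (1 - s) * F c + ennreal s * F d"
      unfolding F_def
      by (subst nn_integral_add) (auto intro!: borel_measurable_times_ennreal fX_meas simp: nn_integral_cmult fX_meas)
    finally show ?thesis .
  qed
  have "F (\<lambda>i. a ! i) \<le> F (\<lambda>i. b ! i)"
  proof (rule majorised_imp_le[OF maj perm])
    fix c :: "nat \<Rightarrow> real" and j k and s :: real
    assume jk: "j < ?n" "k < ?n" and s: "0 \<le> s" "s \<le> 1"
    have "Transposition.transpose j k permutes {..<?n}"
      by (rule permutes_swap_id) (use jk in simp_all)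
    then have "F (\<lambda>i. c (Transposition.transpose j k i)) = F c" by (rule perm)
    then have "F (\<lambda>i. (1 - s) * c i + s * c (Transposition.transpose j k i))
        \<le> ennreal (1 - s) * F c + ennreal s * F c"
      using conv[OF s, of c "\<lambda>i. c (Transposition.transpose j k i)"] by simp
    also have "\<dots> = ennreal (1 - s + s) * F c"
      using s by (simp only: ennreal_plus[of "1 - s" s] distrib_right diff_ge_0_iff_ge)
    finally show "F (\<lambda>i. (1 - s) * c i + s * c (Transposition.transpose j k i)) \<le> F c" by simp
  next
    fix c d :: "nat \<Rightarrow> real" assume "\<And>i. i < ?n \<Longrightarrow> c i = d i"
    then have "(\<Sum>i<?n. c i *\<^sub>R x i) = (\<Sum>i<?n. d i *\<^sub>R x i)" for x :: "nat \<Rightarrow> 'b"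
      by (intro sum.cong) auto
    then show "F c = F d" by (simp only: F_def f_def)
  qed
  then show ?thesis by (simp only: F_def f_def)
qed

section \<open>Domination of weighted sums\<close>

text \<open>With \<open>x = \<delta> - 1\<close>, the denominator \<open>1 - 3 powr (- x)\<close> is at least \<open>x / (1 + x)\<close>, and \<open>1 + 1 / x\<close> is
  at most \<open>2\<close> or at most \<open>2 / x\<close> according to whether \<open>x\<close> is above or below \<open>1\<close>; the two entries
  of the maximum correspond to these cases.\<close>
lemma geometric_constant_le:
  fixes C \<delta> :: real
  assumes "1 \<le> C" "1 < \<delta>"
  shows "2 * (3 * C * 3 powr \<delta>) / (1 - 3 * 3 powr (-\<delta>))
    \<le> max (96 * C * 9 powr \<delta>) (12 * C * 9 powr \<delta> / (\<delta> - 1))"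
proof -
  define x where "x = \<delta> - 1"
  have x: "0 < x" using assms by (simp add: x_def)
  have "1 + x \<le> exp x" by (rule exp_ge_add_one_self)
  also have "exp x \<le> 3 powr x"
  proof -
    have "exp 1 \<le> (3::real)" by (rule exp_le)
    then have "1 \<le> ln (3::real)" by (subst ln_ge_iff) simp_all
    then have "x * 1 \<le> x * ln 3" using x by (intro mult_left_mono) auto
    then show ?thesis by (simp add: powr_def)
  qed
  finally have "1 + x \<le> 3 powr x" .
  moreover have "3 * 3 powr (-\<delta>) = 1 / 3 powr x"
  proof -
    have "3 * 3 powr (-\<delta>) = (3::real) powr 1 * 3 powr (-\<delta>)" by simp
    also have "\<dots> = 3 powr (- x)" by (simp only: powr_add[symmetric] x_def) simp
    finally show ?thesis by (simp add: powr_minus_divide)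
  qed
  ultimately have "3 * 3 powr (-\<delta>) \<le> 1 / (1 + x)"
    using x by (simp add: frac_le)
  moreover have "x / (1 + x) = 1 - 1 / (1 + x)" using x by (simp add: field_simps)
  ultimately have den: "x / (1 + x) \<le> 1 - 3 * 3 powr (-\<delta>)" by linarith
  have "(3::real) powr \<delta> \<le> 9 powr \<delta>" using assms by (intro powr_mono2) auto
  then have num: "2 * (3 * C * 3 powr \<delta>) \<le> 6 * C * 9 powr \<delta>" using assms by simp
  let ?A = "C * 9 powr \<delta>"
  have A: "0 \<le> ?A" using assms by simp
  have "2 * (3 * C * 3 powr \<delta>) / (1 - 3 * 3 powr (-\<delta>)) \<le> 6 * C * 9 powr \<delta> / (x / (1 + x))"
    using num den x assms by (intro frac_le) auto
  also have "\<dots> = 6 * ?A * (1 + 1 / x)" using x by (simp add: field_simps)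
  also have "\<dots> \<le> max (96 * C * 9 powr \<delta>) (12 * C * 9 powr \<delta> / x)"
  proof (cases "1 \<le> x")
    case True
    then have "6 * ?A * (1 + 1 / x) \<le> 6 * ?A * 2"
      using A x by (intro mult_left_mono) (auto simp: field_simps)
    also have "\<dots> \<le> 96 * ?A" using A by simp
    finally show ?thesis by (intro max.coboundedI1) (simp only: mult.assoc)
  next
    case False
    then have "6 * ?A * (1 + 1 / x) \<le> 6 * ?A * (2 / x)"
      using A x by (intro mult_left_mono) (auto simp: field_simps)
    then show ?thesis by (simp add: le_max_iff_disj)
  qed
  finally show ?thesis by (simp only: x_def)
qed

theorem theorem3:
  fixes M :: "'a measure"
    and X :: "nat \<Rightarrow> 'a \<Rightarrow> 'b::{banach, second_countable_topology}"
    and C \<delta> \<theta> :: real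
    and a b :: "real list"
    and n :: nat
  assumes "prob_space M"
    and "prob_space.indep_vars M (\<lambda>_. borel) X UNIV"
    and "\<And>i j. distr M borel (X i) = distr M borel (X j)"
    and "\<And>i. symmetric_rv M (X i)"
    and "C \<ge> 1" and "0 < \<theta>" and "\<theta> < 1" and "\<delta> > 1"
    and "\<And>i. weak_borell M (X i) C \<delta> \<theta>"
    and "length a = n" and "length b = n"
    and "majorised a b"
  shows "dominated M
           (Max {2 / \<theta>, 96 * C * 9 powr \<delta>, 12 * C * 9 powr \<delta> / (\<delta> - 1)}) 2
           (\<lambda>\<omega>. \<Sum>i<n. (a ! i) *\<^sub>R X i \<omega>)
           (\<lambda>\<omega>. \<Sum>i<n. (b ! i) *\<^sub>R X i \<omega>)"
proof -
  interpret prob_space M by fact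
  define \<kappa> where "\<kappa> = Max {2 / \<theta>, 96 * C * 9 powr \<delta>, 12 * C * 9 powr \<delta> / (\<delta> - 1)}"
  have \<kappa>: "2 / \<theta> \<le> \<kappa>" "96 * C * 9 powr \<delta> \<le> \<kappa>" "12 * C * 9 powr \<delta> / (\<delta> - 1) \<le> \<kappa>"
    by (simp_all add: \<kappa>_def)
  have "1 * 1 \<le> C * 9 powr \<delta>"
    using assms(5,8) by (intro mult_mono ge_one_powr_ge_zero) auto
  then have "1 \<le> \<kappa>" using \<kappa>(2) by simp
  have indep: "indep_vars (\<lambda>_. borel) X {..<n}"
    by (rule indep_vars_subset[OF assms(2)]) simp
  have X: "X i \<in> borel_measurable M" for i
    using assms(4)[of i] by (simp add: symmetric_rv_def)
  have S: "(\<lambda>\<omega>. \<Sum>i<n. c i *\<^sub>R X i \<omega>) \<in> borel_measurable M" for c :: "nat \<Rightarrow> real"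
    by (intro borel_measurable_sum borel_measurable_scaleR borel_measurable_const X)
  let ?a = "\<lambda>\<omega>. \<Sum>i<n. (a ! i) *\<^sub>R X i \<omega>" and ?b = "\<lambda>\<omega>. \<Sum>i<n. (b ! i) *\<^sub>R X i \<omega>"
  have "dominated M \<kappa> 2 ?a ?b"
  proof (rule dominated_if_dominated_for_norms[OF S S \<open>1 \<le> \<kappa>\<close>])
    fix N0 :: "'b \<Rightarrow> real" assume N0: "continuous_norm N0"
    \<comment> \<open>Doubling the norm moves the two levels to \<open>1\<close> for \<open>b\<close> and to \<open>2\<close> for \<open>a\<close>.\<close>
    define N where "N x = 2 * N0 x" for x
    have N: "continuous_norm N"
      using continuous_norm_scale[OF N0, of 2] by (simp add: N_def[abs_def])
    note [measurable] = continuous_norm_measurable[OF N] S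
    define p where "p = \<P>(\<omega> in M. N (?b \<omega>) > 1)"
    have p: "0 \<le> p" by (simp add: p_def)
    have b_eq: "\<P>(\<omega> in M. N0 (2 *\<^sub>R ?b \<omega>) > 1) = p"
      by (simp add: p_def N_def continuous_normD(3)[OF N0])
    have a_eq: "\<P>(\<omega> in M. N0 (?a \<omega>) > 1) = \<P>(\<omega> in M. N (?a \<omega>) > 2)"
      by (simp add: N_def)
    have "\<P>(\<omega> in M. N (?a \<omega>) > 2) \<le> \<kappa> * p"
    proof (cases "1 \<le> \<kappa> * p")
      case True
      then show ?thesis using prob_le_1 order_trans by blast
    next
      case False
      have "2 / \<theta> * p \<le> \<kappa> * p" by (rule mult_right_mono[OF \<kappa>(1) p])
      then have "2 / \<theta> * p < 1" using False by linarith
      then have p_\<theta>: "2 * p < \<theta>" using assms(6) by (simp add: field_simps)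
      have "96 * C * 9 powr \<delta> * p \<le> \<kappa> * p" by (rule mult_right_mono[OF \<kappa>(2) p])
      then have p_small: "96 * C * 9 powr \<delta> * p \<le> 1" using False by linarith
      define r where "r = (3::real) powr (-\<delta>)"
      have "3 * r < 1"
      proof -
        have "r < 3 powr (- 1)" unfolding r_def by (rule powr_less_mono) (use assms(8) in simp_all)
        then show ?thesis by (simp add: powr_minus)
      qed
      define D where "D = 3 * C * 3 powr \<delta> * p"
      have tail: "\<P>(\<omega> in M. N (?b \<omega>) > 3 ^ k) \<le> D * r ^ k" for k
      proof -
        have "\<P>(\<omega> in M. N (?b \<omega>) > 3 ^ k) \<le> 3 * C * 3 powr \<delta> * (3 powr (-\<delta>)) ^ k * p"
        proof (rule sum_tail_decay[OF _ _ N assms(5) _ _ p_def p_\<theta> p_small])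
          show "indep_vars (\<lambda>_. borel) (\<lambda>i \<omega>. (b ! i) *\<^sub>R X i \<omega>) {..<n}"
            by (rule indep_vars_compose2[OF indep]) measurable
          show "symmetric_rv M (\<lambda>\<omega>. (b ! i) *\<^sub>R X i \<omega>)" for i
            by (rule symmetric_rv_scaleR[OF assms(4)])
          show "0 \<le> \<delta>" using assms(8) by simp
          show "\<P>(\<omega> in M. N ((b ! i) *\<^sub>R X i \<omega>) > l)
              \<le> C * l powr (-\<delta>) * \<P>(\<omega> in M. N ((b ! i) *\<^sub>R X i \<omega>) > 1)"
            if "\<P>(\<omega> in M. N ((b ! i) *\<^sub>R X i \<omega>) > 1) < \<theta>" "1 \<le> l" for i l
            by (rule weak_borell_scaleR[OF assms(9) N that(2,1)])
        qed
        then show ?thesis by (simp add: D_def r_def mult_ac)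
      qed
      have "ennreal (\<P>(\<omega> in M. N (?a \<omega>) > 2))
          = (\<integral>\<^sup>+\<omega>. indicator {\<omega> \<in> space M. N (?a \<omega>) > 2} \<omega> \<partial>M)"
        by (subst nn_integral_indicator) (simp_all add: emeasure_eq_measure)
      also have "\<dots> \<le> (\<integral>\<^sup>+\<omega>. ennreal (max 0 (N (?a \<omega>) - 1)) \<partial>M)"
      proof (rule nn_integral_mono)
        fix \<omega>
        have "ennreal 1 \<le> ennreal (max 0 (N (?a \<omega>) - 1))" if "2 < N (?a \<omega>)"
          by (rule ennreal_leI) (use that in simp)
        then show "indicator {\<omega> \<in> space M. N (?a \<omega>) > 2} \<omega> \<le> ennreal (max 0 (N (?a \<omega>) - 1))"
          by (simp add: indicator_def)
      qed
      also have "\<dots> \<le> (\<integral>\<^sup>+\<omega>. ennreal (max 0 (N (?b \<omega>) - 1)) \<partial>M)"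
        using nn_integral_excess_mono_majorised[of X a N b] indep assms(3,10,12) N by simp
      also have "\<dots> \<le> ennreal (2 * D / (1 - 3 * r))"
      proof (rule nn_integral_excess_le[OF _ _ _ \<open>3 * r < 1\<close> tail])
        show "0 \<le> D" using p assms(5) by (simp add: D_def)
        show "0 < r" by (simp add: r_def)
      qed measurable
      finally have "\<P>(\<omega> in M. N (?a \<omega>) > 2) \<le> 2 * D / (1 - 3 * r)"
        using p assms(5) \<open>3 * r < 1\<close> by (subst (asm) ennreal_le_iff) (simp_all add: D_def)
      also have "\<dots> = 2 * (3 * C * 3 powr \<delta>) / (1 - 3 * 3 powr (-\<delta>)) * p"
        by (simp add: D_def r_def)
      also have "\<dots> \<le> \<kappa> * p"
        using geometric_constant_le[OF assms(5,8)] \<kappa>(2,3) p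
        by (intro mult_right_mono) auto
      finally show ?thesis .
    qed
    then show "\<P>(\<omega> in M. N0 (?a \<omega>) > 1) \<le> \<kappa> * \<P>(\<omega> in M. N0 (2 *\<^sub>R ?b \<omega>) > 1)"
      by (simp only: a_eq b_eq)
  qed
  then show ?thesis by (simp only: \<kappa>_def)
qed

end
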